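(* Let $\mu,\nu$ be finite positive Borel measures on $\mathbb{R}^d$ such that all moments of $\mu$ and $\nu$ are finite and such that, for some scalar $c>0$, $\int \exp(c|x_i|)\,d\mu<\infty$ and $\int \exp(c|x_i|)\,d\nu<\infty$ for all $i=1,\ldots,d$. For each $n\in\mathbb{N}$ consider the semidefinite program over real vectors $\boldsymbol{\phi}=(\phi_{\boldsymbol{\alpha}})_{\boldsymbol{\alpha}\in\mathbb{N}^d_{2n}}$ and $\boldsymbol{\psi}=(\psi_{\boldsymbol{\alpha}})_{\boldsymbol{\alpha}\in\mathbb{N}^d_{2n}}$: $$(P_n)\qquad \rho_n=\inf_{\boldsymbol{\phi},\boldsymbol{\psi}}\Big\{\phi_{\mathbf 0}+\psi_{\mathbf 0}:\ \phi_{\boldsymbol{\alpha}}-\psi_{\boldsymbol{\alpha}}=\mu_{\boldsymbol{\alpha}}-\nu_{\boldsymbol{\alpha}}\ \ \forall\boldsymbol{\alpha}\in\mathbb{N}^d_{2n};\quad 0\preceq \mathbf{M}_n(\boldsymbol{\phi})\preceq \mathbf{M}_n(\mu);\quad 0\preceq \mathbf{M}_n(\boldsymbol{\psi})\preceq \mathbf{M}_n(\nu)\Big\}.$$ (i) For every fixed $n\in\mathbb{N}$, problem $(P_n)$ has an optimal solution, denoted $(\boldsymbol{\phi}^{(n)},\boldsymbol{\psi}^{(n)})$. (ii) In addition, $\rho_n\uparrow\Vert\mu-\nu\Vert_{TV}$ as $n\to\infty$ (that is, the sequence $(\rho_n)$ is monotone nondecreasing and converges to $\Vert\mu-\nu\Vert_{TV}$),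 and moreover $$\lim_{n\to\infty}\phi^{(n)}_{\boldsymbol{\alpha}}=\int \mathbf{x}^{\boldsymbol{\alpha}}\,d\phi^*_+,\qquad \lim_{n\to\infty}\psi^{(n)}_{\boldsymbol{\alpha}}=\int \mathbf{x}^{\boldsymbol{\alpha}}\,d\phi^*_-,\qquad\forall\boldsymbol{\alpha}\in\mathbb{N}^d,$$ where $(\phi^*_+,\phi^*_-)$ is the Hahn-Jordan decomposition of the signed measure $\mu-\nu$.
   Context: $\mathbb{N}^d_n=\{\boldsymbol{\alpha}\in\mathbb{N}^d:\sum_i\alpha_i\le n\}$. For a measure $\mu$ with finite moments, $\mu_{\boldsymbol{\alpha}}=\int \mathbf{x}^{\boldsymbol{\alpha}}\,d\mu$. For a real vector $\boldsymbol{\phi}=(\phi_{\boldsymbol{\alpha}})_{\boldsymbol{\alpha}\in\mathbb{N}^d_{2n}}$, the moment matrix $\mathbf{M}_n(\boldsymbol{\phi})$ is the real symmetric matrix with rows and columns indexed by $\mathbb{N}^d_n$ and entries $\mathbf{M}_n(\boldsymbol{\phi})(\boldsymbol{\alpha},\boldsymbol{\beta})=\phi_{\boldsymbol{\alpha}+\boldsymbol{\beta}}$; $\mathbf{M}_n(\mu)$ is the moment matrix of the moments of $\mu$ up to degree $2n$. $\mathbf{A}\succeq0$ means positive semidefinite, and $\mathbf{A}\preceq\mathbf{B}$ means $\mathbf{B}-\mathbf{A}\succeq0$. The Hahn-Jordan decomposition $(\phi^*_+,\phi^*_-)$ of $\mu-\nu$ is the unique pair of mutually singular positive measures with $\phi^*_+-\phi^*_-=\mu-\nu$,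 and $\Vert\mu-\nu\Vert_{TV}=\phi^*_+(\mathbb{R}^d)+\phi^*_-(\mathbb{R}^d)$ (no factor $1/2$). *)

theory Defs
  imports "HOL-Analysis.Analysis"
begin

text \<open>Multi-indices are vectors over \<^typ>\<open>nat\<close>, so that \<open>\<alpha> + \<beta>\<close> and \<open>0\<close> are componentwise.\<close>

definition multi_indices :: "nat \<Rightarrow> (nat ^ 'd) set" where
  "multi_indices n = {\<alpha>. (\<Sum>i\<in>UNIV. \<alpha> $ i) \<le> n}"

definition monomial :: "nat ^ 'd \<Rightarrow> real ^ 'd \<Rightarrow> real" where
  "monomial \<alpha> x = (\<Prod>i\<in>UNIV. (x $ i) ^ (\<alpha> $ i))"

definition moment :: "(real ^ 'd) measure \<Rightarrow> nat ^ 'd \<Rightarrow> real" where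
  "moment \<mu> \<alpha> = (\<integral>x. monomial \<alpha> x \<partial>\<mu>)"

text \<open>
  A square matrix with rows and columns indexed by a finite set \<open>I\<close> is a binary function
  of which only the values on \<open>I \<times> I\<close> are used. In particular the order \<open>n\<close> of a moment matrix
  enters only through the index set \<^term>\<open>multi_indices n\<close>.
\<close>

definition psd_on :: "'a set \<Rightarrow> ('a \<Rightarrow> 'a \<Rightarrow> real) \<Rightarrow> bool" where
  "psd_on I A \<longleftrightarrow> (\<forall>a\<in>I. \<forall>b\<in>I. A a b = A b a) \<and>
     (\<forall>v. 0 \<le> (\<Sum>a\<in>I. \<Sum>b\<in>I. v a * A a b * v b))"

definition psd_le_on :: "'a set \<Rightarrow> ('a \<Rightarrow> 'a \<Rightarrow> real) \<Rightarrow> ('a \<Rightarrow> 'a \<Rightarrow> real) \<Rightarrow> bool" where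
  "psd_le_on I A B \<longleftrightarrow> psd_on I (\<lambda>a b. B a b - A a b)"

definition moment_matrix :: "(nat ^ 'd \<Rightarrow> real) \<Rightarrow> nat ^ 'd \<Rightarrow> nat ^ 'd \<Rightarrow> real" where
  "moment_matrix \<phi> \<alpha> \<beta> = \<phi> (\<alpha> + \<beta>)"

text \<open>
  A real vector indexed by \<^term>\<open>multi_indices (2 * n)\<close> is a function in
  \<^const>\<open>extensional\<close> of that set, i.e. equal to \<^const>\<open>undefined\<close> elsewhere.
\<close>

definition feasible ::
  "(real ^ 'd) measure \<Rightarrow> (real ^ 'd) measure \<Rightarrow> nat \<Rightarrow>
    ((nat ^ 'd \<Rightarrow> real) \<times> (nat ^ 'd \<Rightarrow> real)) set" where
  "feasible \<mu> \<nu> n = {(\<phi>, \<psi>).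
     \<phi> \<in> extensional (multi_indices (2 * n)) \<and> \<psi> \<in> extensional (multi_indices (2 * n)) \<and>
     (\<forall>\<alpha>\<in>multi_indices (2 * n). \<phi> \<alpha> - \<psi> \<alpha> = moment \<mu> \<alpha> - moment \<nu> \<alpha>) \<and>
     psd_on (multi_indices n) (moment_matrix \<phi>) \<and>
     psd_le_on (multi_indices n) (moment_matrix \<phi>) (moment_matrix (moment \<mu>)) \<and>
     psd_on (multi_indices n) (moment_matrix \<psi>) \<and>
     psd_le_on (multi_indices n) (moment_matrix \<psi>) (moment_matrix (moment \<nu>))}"

text \<open>
  For the measures considered, the set of attained values is nonempty (take the moments of
  \<open>\<mu>\<close> and \<open>\<nu>\<close>) and bounded below by \<open>0\<close>, so the real-valued infimum is the true one.
\<close>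

definition rho :: "(real ^ 'd) measure \<Rightarrow> (real ^ 'd) measure \<Rightarrow> nat \<Rightarrow> real" where
  "rho \<mu> \<nu> n = (INF (\<phi>, \<psi>)\<in>feasible \<mu> \<nu> n. \<phi> 0 + \<psi> 0)"

definition optimal_solution ::
  "(real ^ 'd) measure \<Rightarrow> (real ^ 'd) measure \<Rightarrow> nat \<Rightarrow>
    (nat ^ 'd \<Rightarrow> real) \<Rightarrow> (nat ^ 'd \<Rightarrow> real) \<Rightarrow> bool" where
  "optimal_solution \<mu> \<nu> n \<phi> \<psi> \<longleftrightarrow> (\<phi>, \<psi>) \<in> feasible \<mu> \<nu> n \<and>
     (\<forall>(\<phi>', \<psi>')\<in>feasible \<mu> \<nu> n. \<phi> 0 + \<psi> 0 \<le> \<phi>' 0 + \<psi>' 0)"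

definition mutually_singular :: "'a measure \<Rightarrow> 'a measure \<Rightarrow> bool" where
  "mutually_singular P Q \<longleftrightarrow> sets P = sets Q \<and>
     (\<exists>A\<in>sets P. emeasure P A = 0 \<and> emeasure Q (space Q - A) = 0)"

definition is_hahn_jordan ::
  "'a measure \<Rightarrow> 'a measure \<Rightarrow> 'a measure \<Rightarrow> 'a measure \<Rightarrow> bool" where
  "is_hahn_jordan \<mu> \<nu> P Q \<longleftrightarrow>
     finite_measure P \<and> finite_measure Q \<and> sets P = sets \<mu> \<and> sets Q = sets \<mu> \<and>
     mutually_singular P Q \<and>
     (\<forall>A\<in>sets \<mu>. measure P A - measure Q A = measure \<mu> A - measure \<nu> A)"

definition hahn_jordan :: "'a measure \<Rightarrow> 'a measure \<Rightarrow> 'a measure \<times> 'a measure" where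
  "hahn_jordan \<mu> \<nu> = (THE (P, Q). is_hahn_jordan \<mu> \<nu> P Q)"

definition jordan_pos :: "'a measure \<Rightarrow> 'a measure \<Rightarrow> 'a measure" where
  "jordan_pos \<mu> \<nu> = fst (hahn_jordan \<mu> \<nu>)"

definition jordan_neg :: "'a measure \<Rightarrow> 'a measure \<Rightarrow> 'a measure" where
  "jordan_neg \<mu> \<nu> = snd (hahn_jordan \<mu> \<nu>)"

text \<open>The total variation norm of \<open>\<mu> - \<nu>\<close>, without the factor \<open>1/2\<close> used by some authors.\<close>

definition tv_norm_diff :: "'a measure \<Rightarrow> 'a measure \<Rightarrow> real" where
  "tv_norm_diff \<mu> \<nu> =
     measure (jordan_pos \<mu> \<nu>) (space \<mu>) + measure (jordan_neg \<mu> \<nu>) (space \<mu>)"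

text \<open>The description in \<^const>\<open>hahn_jordan\<close> is proper for finite measures on the same space.\<close>

lemma is_hahn_jordan_unique_aux:
  assumes 1: "is_hahn_jordan \<mu> \<nu> P Q" and 2: "is_hahn_jordan \<mu> \<nu> P' Q'"
    and B: "B \<in> sets \<mu>"
  shows "measure P B \<le> measure P' B"
proof -
  interpret P: finite_measure P using 1 by (simp add: is_hahn_jordan_def)
  interpret Q: finite_measure Q using 1 by (simp add: is_hahn_jordan_def)
  interpret P': finite_measure P' using 2 by (simp add: is_hahn_jordan_def)
  have s: "sets P = sets \<mu>" "sets Q = sets \<mu>" "sets P' = sets \<mu>"
    using 1 2 by (auto simp: is_hahn_jordan_def)
  have sp: "space P = space \<mu>" "space Q = space \<mu>"
    using s sets_eq_imp_space_eq by blast+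
  obtain A where A: "A \<in> sets \<mu>" "emeasure P A = 0" "emeasure Q (space \<mu> - A) = 0"
    using 1 s sp by (auto simp: is_hahn_jordan_def mutually_singular_def)
  have BA: "B - A \<in> sets \<mu>" "B \<inter> A \<in> sets \<mu>" using B A by auto
  have "emeasure P (B \<inter> A) \<le> emeasure P A"
    using A s by (intro emeasure_mono) auto
  then have P0: "measure P (B \<inter> A) = 0" using A by (simp add: measure_def)
  have "B \<subseteq> space \<mu>" using B sets.sets_into_space by blast
  then have "emeasure Q (B - A) \<le> emeasure Q (space \<mu> - A)"
    using A s by (intro emeasure_mono) auto
  then have Q0: "measure Q (B - A) = 0" using A by (simp add: measure_def)
  have "measure P B = measure P (B - A) + measure P (B \<inter> A)"
    using P.finite_measure_Diff'[of B A] B A s by simp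
  also have "\<dots> = measure P (B - A) - measure Q (B - A)" using P0 Q0 by simp
  also have "\<dots> = measure P' (B - A) - measure Q' (B - A)"
    using 1 2 BA by (simp add: is_hahn_jordan_def)
  also have "\<dots> \<le> measure P' (B - A)" by simp
  also have "\<dots> \<le> measure P' B" using B s by (intro P'.finite_measure_mono) auto
  finally show ?thesis .
qed

lemma is_hahn_jordan_swap:
  assumes hj: "is_hahn_jordan \<mu> \<nu> P Q" and s: "sets \<nu> = sets \<mu>"
  shows "is_hahn_jordan \<nu> \<mu> Q P"
proof -
  have sPQ: "sets P = sets \<mu>" "sets Q = sets \<mu>"
    using hj by (simp_all add: is_hahn_jordan_def)
  then have sp: "space P = space \<mu>" "space Q = space \<mu>"
    using sets_eq_imp_space_eq by blast+
  obtain A where A: "A \<in> sets \<mu>" "emeasure P A = 0" "emeasure Q (space \<mu> - A) = 0"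
    using hj sPQ sp by (auto simp: is_hahn_jordan_def mutually_singular_def)
  have "space \<mu> - (space \<mu> - A) = A" using A(1) sets.sets_into_space by blast
  then have "mutually_singular Q P"
    unfolding mutually_singular_def using A sPQ sp
    by (intro conjI bexI[of _ "space \<mu> - A"]) simp_all
  moreover have "measure Q X - measure P X = measure \<nu> X - measure \<mu> X" if "X \<in> sets \<mu>" for X
  proof -
    have "measure P X - measure Q X = measure \<mu> X - measure \<nu> X"
      using hj that unfolding is_hahn_jordan_def by blast
    then show ?thesis by linarith
  qed
  moreover have "finite_measure P" "finite_measure Q"
    using hj by (simp_all add: is_hahn_jordan_def)
  ultimately show ?thesis
    using s sPQ unfolding is_hahn_jordan_def by simp
qed

lemma is_hahn_jordan_unique:
  assumes "is_hahn_jordan \<mu> \<nu> P Q" "is_hahn_jordan \<mu> \<nu> P' Q'"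
  shows "P = P'"
proof (rule measure_eqI)
  show "sets P = sets P'" using assms by (simp add: is_hahn_jordan_def)
  fix B assume "B \<in> sets P"
  then have B: "B \<in> sets \<mu>" using assms by (simp add: is_hahn_jordan_def)
  have "measure P B = measure P' B"
    by (rule antisym) (use is_hahn_jordan_unique_aux[OF _ _ B] assms in blast)+
  moreover have "finite_measure P" "finite_measure P'"
    using assms by (auto simp: is_hahn_jordan_def)
  ultimately show "emeasure P B = emeasure P' B"
    by (simp add: finite_measure.emeasure_eq_measure)
qed

lemma restricted_difference_measure:
  assumes fin: "finite_measure M" "finite_measure N" and s: "sets N = sets M" and Z: "Z \<in> sets M"
    and le: "\<forall>X\<in>sets M. X \<subseteq> Z \<longrightarrow> emeasure N X \<le> emeasure M X"
  defines "P \<equiv> diff_measure (density M (indicator Z)) (density N (indicator Z))"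
  shows "finite_measure P" "sets P = sets M"
    "\<And>X. X \<in> sets M \<Longrightarrow> emeasure P X = emeasure M (Z \<inter> X) - emeasure N (Z \<inter> X)"
    "\<And>X. X \<in> sets M \<Longrightarrow> measure P X = measure M (Z \<inter> X) - measure N (Z \<inter> X)"
proof -
  interpret M: finite_measure M by fact
  interpret N: finite_measure N by fact
  have M': "emeasure (density M (indicator Z)) X = emeasure M (Z \<inter> X)" if "X \<in> sets M" for X
    using that Z by (simp add: emeasure_restricted)
  have N': "emeasure (density N (indicator Z)) X = emeasure N (Z \<inter> X)" if "X \<in> sets M" for X
    using that Z s by (simp add: emeasure_restricted)
  have sp: "space N = space M" using s sets_eq_imp_space_eq by blast
  have f: "finite_measure (density M (indicator Z))" "finite_measure (density N (indicator Z))"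
    using M'[of "space M"] N'[of "space M"] sp by (intro finite_measureI; simp)+
  have sP: "sets P = sets M" by (simp add: P_def)
  have e: "emeasure P X = emeasure M (Z \<inter> X) - emeasure N (Z \<inter> X)" if "X \<in> sets M" for X
  proof -
    have "emeasure (density N (indicator Z)) A \<le> emeasure (density M (indicator Z)) A"
      if "A \<in> sets M" for A
      unfolding M'[OF that] N'[OF that] using that Z by (intro le[rule_format]) simp_all
    then have "emeasure P X = emeasure (density M (indicator Z)) X - emeasure (density N (indicator Z)) X"
      unfolding P_def using that s by (intro emeasure_diff_measure f) simp_all
    then show ?thesis unfolding M'[OF that] N'[OF that] .
  qed
  have spP: "space P = space M" using sP sets_eq_imp_space_eq by blast
  have fP: "finite_measure P"
    using e[of "space M"] spP
    by (intro finite_measureI) (simp add: M.emeasure_eq_measure N.emeasure_eq_measure ennreal_minus)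
  have m: "measure P X = measure M (Z \<inter> X) - measure N (Z \<inter> X)" if "X \<in> sets M" for X
  proof -
    have "Z \<inter> X \<in> sets M" using that Z by auto
    then have "measure N (Z \<inter> X) \<le> measure M (Z \<inter> X)"
      using le[rule_format, of "Z \<inter> X"] by (simp add: M.emeasure_eq_measure N.emeasure_eq_measure)
    then show ?thesis
      using e[OF that]
      by (simp add: measure_def[of P] M.emeasure_eq_measure N.emeasure_eq_measure ennreal_minus)
  qed
  show "finite_measure P" "sets P = sets M" by fact+
  show "emeasure P X = emeasure M (Z \<inter> X) - emeasure N (Z \<inter> X)" if "X \<in> sets M" for X
    using that by (rule e)
  show "measure P X = measure M (Z \<inter> X) - measure N (Z \<inter> X)" if "X \<in> sets M" for X
    using that by (rule m)
qed

lemma is_hahn_jordan_exists: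
  assumes fin: "finite_measure \<mu>" "finite_measure \<nu>" and s: "sets \<nu> = sets \<mu>"
  shows "\<exists>P Q. is_hahn_jordan \<mu> \<nu> P Q"
proof -
  interpret M: finite_measure \<mu> by fact
  interpret N: finite_measure \<nu> by fact
  have "\<exists>Y\<in>sets \<mu>. Y \<subseteq> space \<mu> \<and> (\<forall>X\<in>sets \<mu>. X \<subseteq> Y \<longrightarrow> emeasure \<nu> X \<le> emeasure \<mu> X) \<and>
      (\<forall>X\<in>sets \<mu>. X \<subseteq> space \<mu> \<longrightarrow> X \<inter> Y = {} \<longrightarrow> emeasure \<mu> X \<le> emeasure \<nu> X)"
    using s by (intro unsigned_Hahn_decomposition) auto
  then obtain Y where Y: "Y \<in> sets \<mu>"
    and Y1: "\<forall>X\<in>sets \<mu>. X \<subseteq> Y \<longrightarrow> emeasure \<nu> X \<le> emeasure \<mu> X"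
    and Y2: "\<forall>X\<in>sets \<mu>. X \<subseteq> space \<mu> \<longrightarrow> X \<inter> Y = {} \<longrightarrow> emeasure \<mu> X \<le> emeasure \<nu> X"
    by (elim bexE conjE)
  have sp: "space \<nu> = space \<mu>" using s sets_eq_imp_space_eq by blast
  define Z where "Z = space \<mu> - Y"
  have Z: "Z \<in> sets \<mu>" using Y by (simp add: Z_def)
  have Y3: "\<forall>X\<in>sets \<nu>. X \<subseteq> Z \<longrightarrow> emeasure \<mu> X \<le> emeasure \<nu> X"
  proof (intro ballI impI)
    fix X assume "X \<in> sets \<nu>" "X \<subseteq> Z"
    then have "X \<subseteq> space \<mu>" "X \<inter> Y = {}" "X \<in> sets \<mu>" using s by (auto simp: Z_def)
    then show "emeasure \<mu> X \<le> emeasure \<nu> X" using Y2 by simp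
  qed
  define P where "P = diff_measure (density \<mu> (indicator Y)) (density \<nu> (indicator Y))"
  note P = restricted_difference_measure[OF fin s Y Y1, folded P_def]
  have Z': "Z \<in> sets \<nu>" using Z s by simp
  define Q where "Q = diff_measure (density \<nu> (indicator Z)) (density \<mu> (indicator Z))"
  note Q = restricted_difference_measure[OF fin(2,1) s[symmetric] Z' Y3, folded Q_def]
  have spQ: "space Q = space \<mu>" by (rule sets_eq_imp_space_eq[OF Q(2)[unfolded s]])
  have "mutually_singular P Q"
    unfolding mutually_singular_def
  proof (intro conjI bexI)
    show "emeasure P Z = 0" using P(3)[OF Z] by (simp add: Z_def)
    have "space Q - Z = Y" using Y sets.sets_into_space spQ by (auto simp: Z_def)
    moreover have "Z \<inter> Y = {}" by (auto simp: Z_def)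
    ultimately show "emeasure Q (space Q - Z) = 0" using Q(3)[of Y] Y s by simp
  qed (use P(2) Q(2) s Z in simp_all)
  moreover have "measure P X - measure Q X = measure \<mu> X - measure \<nu> X" if X: "X \<in> sets \<mu>" for X
  proof -
    have "X \<subseteq> space \<mu>" using X sets.sets_into_space by blast
    then have *: "Y \<inter> X = X \<inter> Y" "Z \<inter> X = X - Y" by (auto simp: Z_def)
    have "measure \<mu> X = measure \<mu> (X \<inter> Y) + measure \<mu> (X - Y)"
      using M.finite_measure_Diff'[OF X Y] by simp
    moreover have "measure \<nu> X = measure \<nu> (X \<inter> Y) + measure \<nu> (X - Y)"
      using N.finite_measure_Diff'[of X Y] X Y s by simp
    ultimately show ?thesis using P(4)[OF X] Q(4)[of X] X s unfolding * by simp
  qed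
  ultimately have "is_hahn_jordan \<mu> \<nu> P Q"
    unfolding is_hahn_jordan_def using P(1,2) Q(1,2) s by simp
  then show ?thesis by (intro exI)
qed

lemma is_hahn_jordan_jordan_parts:
  assumes fin: "finite_measure \<mu>" "finite_measure \<nu>" and s: "sets \<nu> = sets \<mu>"
  shows "is_hahn_jordan \<mu> \<nu> (jordan_pos \<mu> \<nu>) (jordan_neg \<mu> \<nu>)"
proof -
  obtain P Q where PQ: "is_hahn_jordan \<mu> \<nu> P Q"
    using is_hahn_jordan_exists[OF assms] by (elim exE)
  have uniq: "R = (P, Q)" if "case R of (P', Q') \<Rightarrow> is_hahn_jordan \<mu> \<nu> P' Q'" for R
  proof (cases R)
    case (Pair P' Q')
    then have R: "is_hahn_jordan \<mu> \<nu> P' Q'" using that by simp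
    have "P' = P" by (rule is_hahn_jordan_unique[OF R PQ])
    moreover have "Q' = Q"
      by (rule is_hahn_jordan_unique[OF is_hahn_jordan_swap[OF R s] is_hahn_jordan_swap[OF PQ s]])
    ultimately show ?thesis using Pair by simp
  qed
  have "hahn_jordan \<mu> \<nu> = (P, Q)"
    unfolding hahn_jordan_def by (rule the_equality) (simp add: PQ, rule uniq)
  then show ?thesis
    using PQ by (simp add: jordan_pos_def jordan_neg_def)
qed

end

theory Submission
  imports Defs "HOL-Library.Poly_Mapping"
begin

text \<open>
  Let \<open>Y\<close> be a positive set of \<open>\<tau> = \<mu> - \<nu>\<close>. The exponential moments make polynomials dense in
  \<open>L\<^sup>4(\<mu> + \<nu>)\<close>, so some polynomial \<open>p\<close> is close to the indicator of \<open>Y\<close> and \<open>p - p\<^sup>2\<close> is close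
  to \<open>0\<close> in \<open>L\<^sup>2\<close>. For \<open>n\<close> large and \<open>(\<phi>, \<psi>)\<close> feasible, read as functionals on polynomials,
  the Cauchy-Schwarz inequality for \<open>\<phi>\<close> and the bound \<open>\<phi>(q\<^sup>2) \<le> \<mu>(q\<^sup>2)\<close> yield
  \<open>\<phi>(1 - p) \<ge> \<phi>((1 - p)\<^sup>2) - \<epsilon>\<close>, and likewise \<open>\<psi>(p) \<ge> \<psi>(p\<^sup>2) - \<epsilon>\<close>; hence \<open>\<phi>(1) + \<psi>(1)\<close>
  is at least \<open>\<tau>(2p - 1) - 4\<epsilon>\<close>, which is nearly the total variation. For an optimal pair this forces
  \<open>\<phi>((1 - p)\<^sup>2)\<close> and \<open>\<psi>(p\<^sup>2)\<close> to be small, so that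
  \<open>\<phi>(x\<^sup>\<alpha>) = \<phi>(x\<^sup>\<alpha> (1 - p)) + \<psi>(x\<^sup>\<alpha> p) + \<tau>(x\<^sup>\<alpha> p)\<close> is close to the integral of \<open>x\<^sup>\<alpha>\<close> over \<open>Y\<close>
  with respect to \<open>\<tau>\<close>.

  For the density, the bounded functions \<open>g\<close> such that \<open>q g\<close> is approximable for every polynomial \<open>q\<close>
  form an algebra closed under bounded pointwise limits, so the sets whose indicator is of this kind
  form a \<open>\<sigma>\<close>-algebra making all such \<open>g\<close> measurable. By Taylor expansion it makes \<open>sin (s x\<^sub>i)\<close>
  measurable for small \<open>s\<close>, hence also the coordinates \<open>x\<^sub>i = lim sin (s x\<^sub>i) / s\<close>.
\<close>

section \<open>Riesz functionals and polynomials\<close>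

text \<open>Multivariate polynomials are finitely supported coefficient functions on multi-indices.\<close>

definition riesz :: "('a \<Rightarrow> real) \<Rightarrow> ('a \<Rightarrow>\<^sub>0 real) \<Rightarrow> real" where
  "riesz \<phi> p = (\<Sum>\<alpha>\<in>Poly_Mapping.keys p. Poly_Mapping.lookup p \<alpha> * \<phi> \<alpha>)"

lemma riesz_superset:
  assumes "finite A" "Poly_Mapping.keys p \<subseteq> A"
  shows "riesz \<phi> p = (\<Sum>\<alpha>\<in>A. Poly_Mapping.lookup p \<alpha> * \<phi> \<alpha>)"
  unfolding riesz_def using assms by (intro sum.mono_neutral_left) (auto simp: in_keys_iff)

lemma riesz_zero [simp]: "riesz \<phi> 0 = 0"
  by (simp add: riesz_def)

lemma riesz_add: "riesz \<phi> (p + q) = riesz \<phi> p + riesz \<phi> q"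
  using keys_add[of p q]
  by (simp add: riesz_superset[of "Poly_Mapping.keys p \<union> Poly_Mapping.keys q"] lookup_add algebra_simps sum.distrib)

lemma riesz_diff: "riesz \<phi> (p - q) = riesz \<phi> p - riesz \<phi> q"
  using riesz_add[of \<phi> "p - q" q] by simp

lemma riesz_sum: "riesz \<phi> (\<Sum>i\<in>I. p i) = (\<Sum>i\<in>I. riesz \<phi> (p i))"
  by (induction I rule: infinite_finite_induct) (simp_all add: riesz_add)

lemma riesz_single [simp]: "riesz \<phi> (Poly_Mapping.single \<alpha> c) = c * \<phi> \<alpha>"
  by (simp add: riesz_superset[of "{\<alpha>}"])

lemma riesz_one [simp]: "riesz \<phi> (1 :: 'a::zero \<Rightarrow>\<^sub>0 real) = \<phi> 0"
  unfolding single_one[symmetric] riesz_single by simp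

lemma riesz_functional_diff: "riesz (\<lambda>\<alpha>. \<phi> \<alpha> - \<psi> \<alpha>) p = riesz \<phi> p - riesz \<psi> p"
  by (simp add: riesz_def algebra_simps sum_subtractf)

lemma riesz_cong: "(\<And>\<alpha>. \<alpha> \<in> Poly_Mapping.keys p \<Longrightarrow> \<phi> \<alpha> = \<psi> \<alpha>) \<Longrightarrow> riesz \<phi> p = riesz \<psi> p"
  by (simp add: riesz_def)

lemma poly_mapping_eq_sum_single:
  assumes "finite A" "Poly_Mapping.keys p \<subseteq> A"
  shows "p = (\<Sum>\<alpha>\<in>A. Poly_Mapping.single \<alpha> (Poly_Mapping.lookup p \<alpha>))"
proof (rule poly_mapping_eqI)
  fix \<beta>
  have "(\<Sum>\<alpha>\<in>A. Poly_Mapping.lookup p \<alpha> when \<alpha> = \<beta>) = (\<Sum>\<alpha>\<in>A. if \<beta> = \<alpha> then Poly_Mapping.lookup p \<alpha> else 0)"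
    by (intro sum.cong) (auto simp: when_def)
  also have "\<dots> = Poly_Mapping.lookup p \<beta>"
    using assms by (auto simp: in_keys_iff)
  finally show "Poly_Mapping.lookup p \<beta> = Poly_Mapping.lookup (\<Sum>\<alpha>\<in>A. Poly_Mapping.single \<alpha> (Poly_Mapping.lookup p \<alpha>)) \<beta>"
    by (simp add: lookup_sum lookup_single)
qed

text \<open>For \<open>p = q\<close> this is the quadratic form of the moment matrix at the
  coefficient vector of \<open>p\<close>. The index sets may be any finite supersets of the
  supports, so that \<open>multi_indices n\<close> can take their place.\<close>

lemma riesz_mult:
  fixes p q :: "'a::comm_monoid_add \<Rightarrow>\<^sub>0 real"
  assumes "finite A" "Poly_Mapping.keys p \<subseteq> A" "finite B" "Poly_Mapping.keys q \<subseteq> B"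
  shows "riesz \<phi> (p * q) = (\<Sum>\<alpha>\<in>A. \<Sum>\<beta>\<in>B. Poly_Mapping.lookup p \<alpha> * \<phi> (\<alpha> + \<beta>) * Poly_Mapping.lookup q \<beta>)"
proof -
  have "p * q = (\<Sum>\<alpha>\<in>A. \<Sum>\<beta>\<in>B. Poly_Mapping.single (\<alpha> + \<beta>) (Poly_Mapping.lookup p \<alpha> * Poly_Mapping.lookup q \<beta>))"
    by (subst poly_mapping_eq_sum_single[OF assms(1,2)],
        subst poly_mapping_eq_sum_single[OF assms(3,4)])
       (simp add: sum_product mult_single)
  then show ?thesis
    by (simp add: riesz_sum mult_ac)
qed

text \<open>A point value is the Riesz functional of the moments of the Dirac measure at
  \<open>x\<close>, so evaluation inherits linearity and the product formula from
  \<open>riesz\<close>.\<close>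

definition peval :: "(nat ^ 'd \<Rightarrow>\<^sub>0 real) \<Rightarrow> real ^ 'd \<Rightarrow> real" where
  "peval p x = riesz (\<lambda>\<alpha>. monomial \<alpha> x) p"

lemma monomial_zero [simp]: "monomial 0 x = 1"
  by (simp add: monomial_def)

lemma monomial_add: "monomial (\<alpha> + \<beta>) x = monomial \<alpha> x * monomial \<beta> x"
  by (simp add: monomial_def power_add prod.distrib)

lemma peval_one [simp]: "peval 1 x = 1"
  and peval_single [simp]: "peval (Poly_Mapping.single \<alpha> c) x = c * monomial \<alpha> x"
  and peval_add: "peval (p + q) x = peval p x + peval q x"
  and peval_diff: "peval (p - q) x = peval p x - peval q x"
  by (simp_all add: peval_def riesz_add riesz_diff)

lemma peval_mult: "peval (p * q) x = peval p x * peval q x"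
  unfolding peval_def riesz_mult[OF finite_keys order_refl finite_keys order_refl]
  by (simp add: riesz_def sum_product monomial_add mult_ac)

lemma monomial_borel [measurable]: "monomial \<alpha> \<in> borel_measurable borel"
  unfolding monomial_def
  by (intro borel_measurable_continuous_onI continuous_intros)

lemma peval_borel [measurable]: "peval p \<in> borel_measurable borel"
  unfolding peval_def riesz_def by measurable

lemma integrable_peval:
  assumes "\<And>\<alpha>. integrable M (monomial \<alpha>)"
  shows "integrable M (peval p)"
  unfolding peval_def riesz_def using assms by auto

lemma riesz_moment:
  assumes "\<And>\<alpha>. integrable M (monomial \<alpha>)"
  shows "riesz (moment M) p = (\<integral>x. peval p x \<partial>M)"
  unfolding peval_def riesz_def moment_def using assms by (simp add: Bochner_Integration.integral_sum)

section \<open>Multi-indices of bounded total degree\<close>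

lemma multi_indices_mono: "m \<le> n \<Longrightarrow> multi_indices m \<subseteq> multi_indices n"
  by (auto simp: multi_indices_def)

lemma zero_in_multi_indices [simp]: "0 \<in> multi_indices n"
  by (simp add: multi_indices_def)

lemma add_in_multi_indices:
  "\<alpha> \<in> multi_indices m \<Longrightarrow> \<beta> \<in> multi_indices n \<Longrightarrow> \<alpha> + \<beta> \<in> multi_indices (m + n)"
  by (auto simp: multi_indices_def sum.distrib)

lemma finite_multi_indices [simp]: "finite (multi_indices n)"
proof (rule finite_subset)
  show "multi_indices n \<subseteq> vec_lambda ` (UNIV \<rightarrow>\<^sub>E {..n})"
  proof
    fix \<alpha> :: "nat ^ 'd" assume "\<alpha> \<in> multi_indices n"
    then have "(\<Sum>i\<in>UNIV. \<alpha> $ i) \<le> n" by (simp add: multi_indices_def)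
    moreover have "\<alpha> $ i \<le> (\<Sum>i\<in>UNIV. \<alpha> $ i)" for i
      by (rule member_le_sum) auto
    ultimately have "($) \<alpha> \<in> UNIV \<rightarrow>\<^sub>E {..n}"
      by (auto intro: order_trans)
    then show "\<alpha> \<in> vec_lambda ` (UNIV \<rightarrow>\<^sub>E {..n})"
      by (metis image_eqI vec_nth_inverse)
  qed
qed (simp add: finite_PiE)

lemma keys_subset_multi_indices: "\<exists>n. Poly_Mapping.keys p \<subseteq> multi_indices n"
proof -
  have "(\<Sum>i\<in>UNIV. \<alpha> $ i) \<le> (\<Sum>\<alpha>\<in>Poly_Mapping.keys p. \<Sum>i\<in>UNIV. \<alpha> $ i)" if "\<alpha> \<in> Poly_Mapping.keys p" for \<alpha>
    using that by (intro member_le_sum) auto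
  then show ?thesis by (auto simp: multi_indices_def)
qed

lemma keys_mult_multi_indices:
  assumes "Poly_Mapping.keys p \<subseteq> multi_indices m" "Poly_Mapping.keys q \<subseteq> multi_indices n"
  shows "Poly_Mapping.keys (p * q) \<subseteq> multi_indices (m + n)"
  using keys_mult[of p q] add_in_multi_indices assms by blast

text \<open>Induction on \<open>k\<close> moves one unit at a time from a nonzero component of the
  remainder \<open>\<beta>\<close> to \<open>\<alpha>\<close>.\<close>

lemma multi_index_sub:
  fixes \<gamma> :: "nat ^ 'd"
  assumes "k \<le> (\<Sum>i\<in>UNIV. \<gamma> $ i)"
  shows "\<exists>\<alpha> \<beta>. \<gamma> = \<alpha> + \<beta> \<and> (\<Sum>i\<in>UNIV. \<alpha> $ i) = k"
  using assms
proof (induction k)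
  case 0
  then show ?case by (intro exI[of _ 0] exI[of _ \<gamma>]) simp
next
  case (Suc k)
  then obtain \<alpha> \<beta> where ab: "\<gamma> = \<alpha> + \<beta>" "(\<Sum>i\<in>UNIV. \<alpha> $ i) = k" by auto
  have "(\<Sum>i\<in>UNIV. \<gamma> $ i) = k + (\<Sum>i\<in>UNIV. \<beta> $ i)"
    unfolding ab(1) by (simp add: sum.distrib ab(2))
  then have "(\<Sum>i\<in>UNIV. \<beta> $ i) \<noteq> 0"
    using Suc.prems by linarith
  then obtain i where i: "\<beta> $ i \<noteq> 0" by (rule sum.not_neutral_contains_not_neutral)
  have "\<gamma> = (\<alpha> + axis i 1) + (\<beta> - axis i 1)"
    using i ab by (auto simp: vec_eq_iff axis_def)
  moreover have "(\<Sum>j\<in>UNIV. (\<alpha> + axis i 1) $ j) = Suc k"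
    using ab by (simp add: sum.distrib axis_def)
  ultimately show ?case by blast
qed

text \<open>Splitting off total degree \<open>min n\<close> of that of \<open>\<gamma>\<close>
  leaves at most \<open>n\<close>. Hence every coordinate of a vector of degree \<open>2 * n\<close>
  is an entry of its moment matrix, and bounds on the matrix control the whole vector.\<close>

lemma multi_indices_double_split:
  assumes "\<gamma> \<in> multi_indices (2 * n)"
  shows "\<exists>\<alpha>\<in>multi_indices n. \<exists>\<beta>\<in>multi_indices n. \<gamma> = \<alpha> + \<beta>"
proof -
  have le: "(\<Sum>i\<in>UNIV. \<gamma> $ i) \<le> 2 * n" using assms by (simp add: multi_indices_def)
  obtain \<alpha> \<beta> where ab: "\<gamma> = \<alpha> + \<beta>" "(\<Sum>i\<in>UNIV. \<alpha> $ i) = min n (\<Sum>i\<in>UNIV. \<gamma> $ i)"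
    using multi_index_sub[of "min n (\<Sum>i\<in>UNIV. \<gamma> $ i)" \<gamma>] by auto
  have "(\<Sum>i\<in>UNIV. \<gamma> $ i) = (\<Sum>i\<in>UNIV. \<alpha> $ i) + (\<Sum>i\<in>UNIV. \<beta> $ i)"
    using ab by (simp add: sum.distrib)
  then have "\<alpha> \<in> multi_indices n" "\<beta> \<in> multi_indices n"
    using le ab by (auto simp: multi_indices_def)
  then show ?thesis using ab by auto
qed

text \<open>Test vectors on \<open>multi_indices n\<close> are the coefficient vectors of
  polynomials of degree at most \<open>n\<close>; symmetry is automatic because addition of indices
  commutes.\<close>

lemma psd_on_riesz_iff:
  "psd_on (multi_indices n) (moment_matrix \<phi>) \<longleftrightarrow>
    (\<forall>p. Poly_Mapping.keys p \<subseteq> multi_indices n \<longrightarrow> 0 \<le> riesz \<phi> (p * p))" (is "?L \<longleftrightarrow> ?R")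
proof
  assume ?L
  then show ?R
    by (auto simp: psd_on_def moment_matrix_def
        riesz_mult[OF finite_multi_indices _ finite_multi_indices])
next
  assume R: ?R
  have "0 \<le> (\<Sum>a\<in>multi_indices n. \<Sum>b\<in>multi_indices n. v a * \<phi> (a + b) * v b)" for v
  proof -
    define p where "p = (\<Sum>a\<in>multi_indices n. Poly_Mapping.single a (v a))"
    have l: "Poly_Mapping.lookup p a = v a" if "a \<in> multi_indices n" for a
    proof -
      have "Poly_Mapping.lookup p a = (\<Sum>b\<in>multi_indices n. if a = b then v b else 0)"
        unfolding p_def by (auto simp: lookup_sum lookup_single when_def intro!: sum.cong)
      then show ?thesis using that by simp
    qed
    have k: "Poly_Mapping.keys p \<subseteq> multi_indices n"
      unfolding p_def using keys_sum by (fastforce split: if_splits)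
    have "0 \<le> riesz \<phi> (p * p)" using R k by blast
    then show ?thesis
      by (simp add: riesz_mult[OF finite_multi_indices k finite_multi_indices k] l)
  qed
  then show ?L by (auto simp: psd_on_def moment_matrix_def add.commute)
qed

lemma psd_le_on_riesz_iff:
  "psd_le_on (multi_indices n) (moment_matrix \<phi>) (moment_matrix \<psi>) \<longleftrightarrow>
    (\<forall>p. Poly_Mapping.keys p \<subseteq> multi_indices n \<longrightarrow> riesz \<phi> (p * p) \<le> riesz \<psi> (p * p))"
  using psd_on_riesz_iff[of n "\<lambda>\<alpha>. \<psi> \<alpha> - \<phi> \<alpha>"]
  by (simp add: psd_le_on_def moment_matrix_def[abs_def] riesz_functional_diff)

text \<open>The common core of both Cauchy-Schwarz inequalities below. The leading coefficient may
  vanish, since the forms involved are only semidefinite.\<close>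

lemma quadratic_nonneg_discriminant:
  fixes a b c :: real
  assumes "\<And>t. 0 \<le> a + 2 * t * b + t\<^sup>2 * c"
  shows "b\<^sup>2 \<le> a * c"
proof (cases "c = 0")
  case True
  \<comment> \<open>With \<open>b\<close> nonzero, this \<open>t\<close> would give the affine
    function the value -1.\<close>
  then have "b = 0"
    using assms[of "(- 1 - a) / (2 * b)"] by (cases "b = 0") (auto simp: field_simps)
  then show ?thesis using True by simp
next
  case False
  have "0 \<le> c"
  proof (rule ccontr)
    assume "\<not> 0 \<le> c"
    \<comment> \<open>Chosen so that the quadratic term is \<open>- (\<bar>a\<bar> + 1)\<close>;
      adding the hypotheses at \<open>s\<close> and \<open>- s\<close> cancels the linear term and
      leaves a negative number.\<close>
    define s where "s = sqrt ((\<bar>a\<bar> + 1) / (- c))"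
    have "s\<^sup>2 = (\<bar>a\<bar> + 1) / (- c)"
      unfolding s_def using \<open>\<not> 0 \<le> c\<close> by (intro real_sqrt_pow2) (simp add: divide_nonneg_neg)
    then have "s\<^sup>2 * c = - (\<bar>a\<bar> + 1)" using \<open>\<not> 0 \<le> c\<close> by simp
    then show False using assms[of s] assms[of "- s"] by simp
  qed
  then have "c > 0" using False by simp
  \<comment> \<open>The value at the vertex of the parabola.\<close>
  moreover have "a + 2 * (- b / c) * b + (- b / c)\<^sup>2 * c = (a * c - b\<^sup>2) / c"
    using False by (simp add: field_simps power2_eq_square)
  ultimately show ?thesis using assms[of "- b / c"] by (simp add: zero_le_divide_iff)
qed

text \<open>Nonnegativity on the squares of \<open>p + t q\<close>, for all real \<open>t\<close>,
  is nonnegativity of a quadratic in \<open>t\<close>.\<close>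

lemma riesz_Cauchy_Schwarz:
  fixes p q :: "nat ^ 'd \<Rightarrow>\<^sub>0 real"
  assumes psd: "psd_on (multi_indices n) (moment_matrix \<phi>)"
    and p: "Poly_Mapping.keys p \<subseteq> multi_indices n" and q: "Poly_Mapping.keys q \<subseteq> multi_indices n"
  shows "(riesz \<phi> (p * q))\<^sup>2 \<le> riesz \<phi> (p * p) * riesz \<phi> (q * q)"
proof (rule quadratic_nonneg_discriminant)
  fix t :: real
  \<comment> \<open>Scalars enter as constant polynomials, which have degree 0 and so do not enlarge
    the support.\<close>
  let ?c = "\<lambda>c. Poly_Mapping.single (0 :: nat ^ 'd) c"
  have c: "riesz \<phi> (?c s * r) = s * riesz \<phi> r" for s r
  proof -
    have "riesz \<phi> (?c s * r) = (\<Sum>\<beta>\<in>Poly_Mapping.keys r. s * \<phi> \<beta> * Poly_Mapping.lookup r \<beta>)"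
      by (subst riesz_mult[of "{0}" _ "Poly_Mapping.keys r"]) simp_all
    then show ?thesis
      by (simp add: riesz_def sum_distrib_left mult_ac)
  qed
  have "Poly_Mapping.keys (?c t * q) \<subseteq> multi_indices n"
    using keys_mult_multi_indices[of "?c t" 0 q n] q by auto
  then have "Poly_Mapping.keys (p + ?c t * q) \<subseteq> multi_indices n"
    using keys_add[of p "?c t * q"] p by blast
  then have "0 \<le> riesz \<phi> ((p + ?c t * q) * (p + ?c t * q))"
    using psd by (simp add: psd_on_riesz_iff)
  also have "(p + ?c t * q) * (p + ?c t * q) =
      p * p + ((?c t * (p * q) + ?c t * (p * q)) + ?c t * (?c t * (q * q)))"
    by (simp only: ring_distribs mult_ac add_ac)
  finally show "0 \<le> riesz \<phi> (p * p) + 2 * t * riesz \<phi> (p * q) + t\<^sup>2 * riesz \<phi> (q * q)"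
    unfolding riesz_add c by (simp add: power2_eq_square algebra_simps)
qed

section \<open>Density of polynomials\<close>

text \<open>Convexity of the square, applied twice. It takes the place of the triangle inequality of
  the fourth-power norm.\<close>

lemma power4_add_le: "((a :: real) + b) ^ 4 \<le> 8 * (a ^ 4 + b ^ 4)"
proof -
  have s: "(x + y)\<^sup>2 \<le> 2 * (x\<^sup>2 + y\<^sup>2)" for x y :: real
    using sum_squares_bound[of x y] by (simp add: power2_sum)
  have "(a + b) ^ 4 = ((a + b)\<^sup>2)\<^sup>2" by (simp flip: power_mult)
  also have "\<dots> \<le> (2 * (a\<^sup>2 + b\<^sup>2))\<^sup>2" by (intro power_mono s) simp
  also have "\<dots> = 4 * (a\<^sup>2 + b\<^sup>2)\<^sup>2" unfolding power_mult_distrib by simp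
  also have "\<dots> \<le> 4 * (2 * ((a\<^sup>2)\<^sup>2 + (b\<^sup>2)\<^sup>2))" by (intro mult_left_mono s) simp
  also have "\<dots> = 8 * (a ^ 4 + b ^ 4)" by (simp flip: power_mult)
  finally show ?thesis .
qed

section \<open>The algebra of polynomial functions\<close>

lemma range_peval_const: "(\<lambda>x. c) \<in> range peval"
  by (rule range_eqI[of _ _ "Poly_Mapping.single 0 c"]) (simp add: fun_eq_iff)

lemma range_peval_nth: "(\<lambda>x :: real ^ 'd. x $ i) \<in> range peval"
proof (rule range_eqI)
  have "(\<Prod>j\<in>UNIV. x $ j ^ (axis i 1 $ j)) = (\<Prod>j\<in>UNIV. if i = j then x $ j else 1)"
    for x :: "real ^ 'd"
    by (intro prod.cong) (auto simp: axis_def)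
  then show "(\<lambda>x. x $ i) = peval (Poly_Mapping.single (axis i 1) 1)"
    by (simp add: fun_eq_iff monomial_def)
qed

lemma range_peval_add: "f \<in> range peval \<Longrightarrow> g \<in> range peval \<Longrightarrow> (\<lambda>x. f x + g x) \<in> range peval"
  by (auto simp: fun_eq_iff image_iff peval_add[symmetric])

lemma range_peval_mult: "f \<in> range peval \<Longrightarrow> g \<in> range peval \<Longrightarrow> (\<lambda>x. f x * g x) \<in> range peval"
  by (auto simp: fun_eq_iff image_iff peval_mult[symmetric])

lemma range_peval_power: "f \<in> range peval \<Longrightarrow> (\<lambda>x. f x ^ n) \<in> range peval"
  by (induction n) (simp_all add: range_peval_const range_peval_mult)

lemma range_peval_sum:
  "(\<And>i. i \<in> I \<Longrightarrow> f i \<in> range peval) \<Longrightarrow> (\<lambda>x. \<Sum>i\<in>I. f i x) \<in> range peval"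
  by (induction I rule: infinite_finite_induct)
    (simp_all add: range_peval_const range_peval_add)

text \<open>A finite set of measures, rather than a single one, lets the same polynomial approximate
  with respect to \<open>\<mu>\<close> and \<open>\<nu>\<close> at once.\<close>

locale exp_moments =
  fixes S :: "(real ^ 'd) measure set" and c :: real
  assumes finite_S: "finite S" and c_pos: "0 < c"
    and finite_measure: "M \<in> S \<Longrightarrow> finite_measure M"
    and sets_borel: "M \<in> S \<Longrightarrow> sets M = sets borel"
    and integrable_monomial: "M \<in> S \<Longrightarrow> integrable M (monomial \<alpha>)"
    and integrable_exp: "M \<in> S \<Longrightarrow> integrable M (\<lambda>x. exp (c * \<bar>x $ i\<bar>))"
begin

section \<open>Fourth-power integrable functions and their approximation by polynomials\<close>

lemma integrable_range_peval: "M \<in> S \<Longrightarrow> f \<in> range peval \<Longrightarrow> integrable M f"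
  using integrable_peval integrable_monomial by blast

lemma borel_measurable_S: "M \<in> S \<Longrightarrow> f \<in> borel_measurable borel \<Longrightarrow> f \<in> borel_measurable M"
  using sets_borel measurable_cong_sets by blast

text \<open>The exponent is 4 because the square of an approximation error has to be small in mean
  square when \<open>p - p\<^sup>2\<close> is estimated.\<close>

definition L4 :: "(real ^ 'd \<Rightarrow> real) set" where
  "L4 = {f \<in> borel_measurable borel. \<forall>M\<in>S. integrable M (\<lambda>x. f x ^ 4)}"

lemma L4_add:
  assumes "f \<in> L4" "g \<in> L4" shows "(\<lambda>x. f x + g x) \<in> L4"
proof -
  have m [measurable]: "f \<in> borel_measurable borel" "g \<in> borel_measurable borel"
    using assms by (auto simp: L4_def)
  have "integrable M (\<lambda>x. (f x + g x) ^ 4)" if M: "M \<in> S" for M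
  proof (rule Bochner_Integration.integrable_bound)
    show "integrable M (\<lambda>x. 8 * (f x ^ 4 + g x ^ 4))"
      using assms M by (auto simp: L4_def)
    show "(\<lambda>x. (f x + g x) ^ 4) \<in> borel_measurable M"
      using M by (rule borel_measurable_S) measurable
    show "AE x in M. norm ((f x + g x) ^ 4) \<le> norm (8 * (f x ^ 4 + g x ^ 4))"
      using power4_add_le by (auto intro!: AE_I2)
  qed
  then show ?thesis by (simp add: L4_def)
qed

lemma L4_mult_bounded:
  assumes f: "f \<in> L4" and g [measurable]: "g \<in> borel_measurable borel" and b: "\<And>x. \<bar>g x\<bar> \<le> B"
  shows "(\<lambda>x. f x * g x) \<in> L4"
proof -
  have m [measurable]: "f \<in> borel_measurable borel" using f by (auto simp: L4_def)
  have "integrable M (\<lambda>x. (f x * g x) ^ 4)" if M: "M \<in> S" for M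
  proof (rule Bochner_Integration.integrable_bound)
    show "integrable M (\<lambda>x. B ^ 4 * f x ^ 4)"
      using assms M by (auto simp: L4_def)
    show "(\<lambda>x. (f x * g x) ^ 4) \<in> borel_measurable M"
      using M by (rule borel_measurable_S) measurable
    have "\<bar>g x ^ 4\<bar> \<le> B ^ 4" for x
      using power_mono[OF b abs_ge_zero, of x 4] by (simp add: power_abs)
    then have "g x ^ 4 * f x ^ 4 \<le> B ^ 4 * f x ^ 4" for x
      by (intro mult_right_mono) auto
    then show "AE x in M. norm ((f x * g x) ^ 4) \<le> norm (B ^ 4 * f x ^ 4)"
      by (intro AE_I2) (simp add: power_mult_distrib mult.commute)
  qed
  then show ?thesis by (simp add: L4_def)
qed

lemma L4_uminus: "f \<in> L4 \<Longrightarrow> (\<lambda>x. - f x) \<in> L4"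
  by (simp add: L4_def)

lemma L4_diff: "f \<in> L4 \<Longrightarrow> g \<in> L4 \<Longrightarrow> (\<lambda>x. f x - g x) \<in> L4"
  using L4_add[OF _ L4_uminus] by fastforce

lemma L4_range_peval: "f \<in> range peval \<Longrightarrow> f \<in> L4"
  using integrable_range_peval[OF _ range_peval_power] by (auto simp: L4_def)

lemma L4_peval: "peval p \<in> L4"
  by (rule L4_range_peval) simp

lemma L4_integral_add_le:
  assumes "f \<in> L4" "g \<in> L4" "M \<in> S"
  shows "(\<integral>x. (f x + g x) ^ 4 \<partial>M) \<le> 8 * ((\<integral>x. f x ^ 4 \<partial>M) + (\<integral>x. g x ^ 4 \<partial>M))"
proof -
  have "(\<integral>x. (f x + g x) ^ 4 \<partial>M) \<le> (\<integral>x. 8 * (f x ^ 4 + g x ^ 4) \<partial>M)"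
    using assms L4_add[of f g] power4_add_le by (intro integral_mono) (auto simp: L4_def)
  then show ?thesis using assms by (simp add: L4_def)
qed

text \<open>The closure of the polynomials in the fourth-power mean, simultaneously for all measures
  in \<open>S\<close>.\<close>

definition approx :: "(real ^ 'd \<Rightarrow> real) set" where
  "approx = {f \<in> L4. \<forall>\<epsilon>>0. \<exists>p. \<forall>M\<in>S. (\<integral>x. (f x - peval p x) ^ 4 \<partial>M) < \<epsilon>}"

lemma approx_L4: "f \<in> approx \<Longrightarrow> f \<in> L4"
  by (simp add: approx_def)

lemma approx_close:
  assumes f: "f \<in> L4"
    and close: "\<And>\<epsilon>. 0 < \<epsilon> \<Longrightarrow> \<exists>g\<in>approx. \<forall>M\<in>S. (\<integral>x. (f x - g x) ^ 4 \<partial>M) < \<epsilon>"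
  shows "f \<in> approx"
proof -
  have "\<exists>p. \<forall>M\<in>S. (\<integral>x. (f x - peval p x) ^ 4 \<partial>M) < \<epsilon>" if "0 < \<epsilon>" for \<epsilon>
  proof -
    \<comment> \<open>The factor 8 of \<open>L4_integral_add_le\<close> and the two error terms
      together account for 16.\<close>
    have e: "0 < \<epsilon> / 16" using that by simp
    obtain g where g: "g \<in> approx" "\<forall>M\<in>S. (\<integral>x. (f x - g x) ^ 4 \<partial>M) < \<epsilon> / 16"
      using close[OF e] by blast
    obtain p where p: "\<forall>M\<in>S. (\<integral>x. (g x - peval p x) ^ 4 \<partial>M) < \<epsilon> / 16"
      using g(1) e unfolding approx_def by blast
    have "(\<integral>x. (f x - peval p x) ^ 4 \<partial>M) < \<epsilon>" if M: "M \<in> S" for M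
    proof -
      have "(\<integral>x. ((f x - g x) + (g x - peval p x)) ^ 4 \<partial>M)
          \<le> 8 * ((\<integral>x. (f x - g x) ^ 4 \<partial>M) + (\<integral>x. (g x - peval p x) ^ 4 \<partial>M))"
        by (rule L4_integral_add_le[OF L4_diff[OF f approx_L4[OF g(1)]]
              L4_diff[OF approx_L4[OF g(1)] L4_peval] M])
      also have "\<dots> < \<epsilon>" using g(2) p M by force
      finally show ?thesis by simp
    qed
    then show ?thesis by blast
  qed
  then show ?thesis using f by (simp add: approx_def)
qed

lemma approx_range_peval:
  assumes "f \<in> range peval" shows "f \<in> approx"
proof -
  obtain p where "f = peval p" using assms by blast
  then show ?thesis
    using L4_range_peval[OF assms] by (auto simp: approx_def intro!: exI[of _ p])
qed

lemma approx_add: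
  assumes f: "f \<in> approx" and g: "g \<in> approx"
  shows "(\<lambda>x. f x + g x) \<in> approx"
proof -
  have L: "f \<in> L4" "g \<in> L4" using f g by (auto intro: approx_L4)
  have "\<exists>p. \<forall>M\<in>S. (\<integral>x. (f x + g x - peval p x) ^ 4 \<partial>M) < \<epsilon>" if "0 < \<epsilon>" for \<epsilon>
  proof -
    have e: "0 < \<epsilon> / 16" using that by simp
    obtain p where p: "\<forall>M\<in>S. (\<integral>x. (f x - peval p x) ^ 4 \<partial>M) < \<epsilon> / 16"
      using f e unfolding approx_def by blast
    obtain q where q: "\<forall>M\<in>S. (\<integral>x. (g x - peval q x) ^ 4 \<partial>M) < \<epsilon> / 16"
      using g e unfolding approx_def by blast
    have "(\<integral>x. (f x + g x - peval (p + q) x) ^ 4 \<partial>M) < \<epsilon>" if M: "M \<in> S" for M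
    proof -
      have "(\<integral>x. ((f x - peval p x) + (g x - peval q x)) ^ 4 \<partial>M)
          \<le> 8 * ((\<integral>x. (f x - peval p x) ^ 4 \<partial>M) + (\<integral>x. (g x - peval q x) ^ 4 \<partial>M))"
        by (rule L4_integral_add_le[OF L4_diff[OF L(1) L4_peval] L4_diff[OF L(2) L4_peval] M])
      also have "\<dots> < \<epsilon>" using q p M by force
      finally show ?thesis by (simp add: peval_add algebra_simps)
    qed
    then show ?thesis by blast
  qed
  then show ?thesis using L4_add[OF L] by (simp add: approx_def)
qed

text \<open>Both \<open>f\<close> and \<open>F k\<close> are bounded by \<open>D\<close>, so
  \<open>16 * D x ^ 4\<close> dominates the fourth power of their difference, and dominated
  convergence makes its integral tend to 0.\<close>

lemma approx_dominated:
  assumes F: "\<And>k. F k \<in> approx" and f [measurable]: "f \<in> borel_measurable borel"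
    and lim: "\<And>x. (\<lambda>k. F k x) \<longlonglongrightarrow> f x" and D: "D \<in> L4" and dom: "\<And>k x. \<bar>F k x\<bar> \<le> D x"
  shows "f \<in> approx"
proof (rule approx_close)
  have [measurable]: "F k \<in> borel_measurable borel" "D \<in> borel_measurable borel" for k
    using F D by (auto simp: L4_def approx_def)
  have domf: "\<bar>f x\<bar> \<le> D x" for x
    using dom by (intro LIMSEQ_le_const2[OF tendsto_rabs[OF lim]]) auto
  have D4: "\<bar>t\<bar> \<le> D x \<Longrightarrow> t ^ 4 \<le> D x ^ 4" for t x
    using power_mono[of "\<bar>t\<bar>" "D x" 4] by simp
  have "integrable M (\<lambda>x. f x ^ 4)" if M: "M \<in> S" for M
  proof (rule Bochner_Integration.integrable_bound)
    show "integrable M (\<lambda>x. D x ^ 4)" using D M by (simp add: L4_def)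
    show "(\<lambda>x. f x ^ 4) \<in> borel_measurable M"
      using M by (rule borel_measurable_S) measurable
    show "AE x in M. norm (f x ^ 4) \<le> norm (D x ^ 4)"
      using D4[OF domf] by (intro AE_I2) simp
  qed
  then show "f \<in> L4" by (simp add: L4_def)
  fix \<epsilon> :: real assume "0 < \<epsilon>"
  have "(\<lambda>k. \<integral>x. (f x - F k x) ^ 4 \<partial>M) \<longlonglongrightarrow> (\<integral>x. 0 \<partial>M)" if M: "M \<in> S" for M
  proof (rule integral_dominated_convergence)
    show "integrable M (\<lambda>x. 16 * D x ^ 4)" using D M by (simp add: L4_def)
    show "(\<lambda>x. (f x - F k x) ^ 4) \<in> borel_measurable M" for k
      using M by (rule borel_measurable_S) measurable
    show "AE x in M. (\<lambda>k. (f x - F k x) ^ 4) \<longlonglongrightarrow> 0"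
    proof (intro AE_I2)
      fix x
      have "(\<lambda>k. (f x - F k x) ^ 4) \<longlonglongrightarrow> (f x - f x) ^ 4"
        by (intro tendsto_intros lim)
      then show "(\<lambda>k. (f x - F k x) ^ 4) \<longlonglongrightarrow> 0" by simp
    qed
    show "AE x in M. norm ((f x - F k x) ^ 4) \<le> 16 * D x ^ 4" for k
    proof (intro AE_I2)
      fix x
      have "(f x + (- F k x)) ^ 4 \<le> 8 * (f x ^ 4 + (- F k x) ^ 4)" by (rule power4_add_le)
      also have "\<dots> \<le> 16 * D x ^ 4"
        using D4[OF domf, of x] D4[OF dom, of k x] by simp
      finally show "norm ((f x - F k x) ^ 4) \<le> 16 * D x ^ 4" by simp
    qed
  qed simp
  then have "\<forall>M\<in>S. \<forall>\<^sub>F k in sequentially. (\<integral>x. (f x - F k x) ^ 4 \<partial>M) < \<epsilon>"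
    using \<open>0 < \<epsilon>\<close> by (auto dest: order_tendstoD)
  \<comment> \<open>Finiteness of \<open>S\<close> turns one threshold per measure into a common
    one.\<close>
  then have "\<forall>\<^sub>F k in sequentially. \<forall>M\<in>S. (\<integral>x. (f x - F k x) ^ 4 \<partial>M) < \<epsilon>"
    using finite_S by (simp add: eventually_ball_finite_distrib)
  then have "\<exists>k. \<forall>M\<in>S. (\<integral>x. (f x - F k x) ^ 4 \<partial>M) < \<epsilon>"
    by (auto simp: eventually_sequentially)
  then show "\<exists>g\<in>approx. \<forall>M\<in>S. (\<integral>x. (f x - g x) ^ 4 \<partial>M) < \<epsilon>"
    using F by blast
qed

text \<open>Asking for approximability of \<open>q g\<close> with every polynomial \<open>q\<close>,
  and not just of \<open>g\<close>, is what makes the class closed under products.\<close>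

definition multipliers :: "(real ^ 'd \<Rightarrow> real) set" where
  "multipliers = {g \<in> borel_measurable borel. (\<exists>B. \<forall>x. \<bar>g x\<bar> \<le> B) \<and>
     (\<forall>q. (\<lambda>x. peval q x * g x) \<in> approx)}"

lemma multipliers_const: "(\<lambda>x. a) \<in> multipliers"
  by (auto simp: multipliers_def intro!: approx_range_peval range_peval_mult range_peval_const)

lemma multipliers_add:
  assumes "f \<in> multipliers" "g \<in> multipliers"
  shows "(\<lambda>x. f x + g x) \<in> multipliers"
proof -
  obtain A B where "\<forall>x. \<bar>f x\<bar> \<le> A" "\<forall>x. \<bar>g x\<bar> \<le> B"
    using assms by (auto simp: multipliers_def)
  then have "\<forall>x. \<bar>f x + g x\<bar> \<le> A + B" by (meson abs_triangle_ineq add_mono order_trans)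
  then show ?thesis
    using assms by (auto simp: multipliers_def distrib_left intro!: approx_add)
qed

text \<open>Approximate \<open>q f\<close> by a polynomial \<open>p\<close>. Boundedness of
  \<open>g\<close> carries the error over from \<open>q f - p\<close> to \<open>q f g - p g\<close>,
  and \<open>p g\<close> is approximable because \<open>g\<close> is a multiplier.\<close>

lemma multipliers_mult:
  assumes f: "f \<in> multipliers" and g: "g \<in> multipliers"
  shows "(\<lambda>x. f x * g x) \<in> multipliers"
proof -
  obtain A B where A: "\<forall>x. \<bar>f x\<bar> \<le> A" and B: "\<forall>x. \<bar>g x\<bar> \<le> B"
    using assms by (auto simp: multipliers_def)
  then have AB: "\<forall>x. \<bar>f x * g x\<bar> \<le> A * B"
    unfolding abs_mult by (meson abs_ge_zero mult_mono order_trans)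
  have [measurable]: "f \<in> borel_measurable borel" "g \<in> borel_measurable borel"
    using assms by (auto simp: multipliers_def)
  have "(\<lambda>x. peval q x * (f x * g x)) \<in> approx" for q
  proof (rule approx_close)
    have qf: "(\<lambda>x. peval q x * f x) \<in> approx" using f by (simp add: multipliers_def)
    show "(\<lambda>x. peval q x * (f x * g x)) \<in> L4"
      using L4_mult_bounded[OF approx_L4[OF qf], of g B] B by (simp add: mult.assoc)
    fix \<epsilon> :: real assume e: "0 < \<epsilon>"
    \<comment> \<open>The added 1 keeps \<open>K\<close> positive, so that
      \<open>\<epsilon> / K\<close> is an admissible tolerance.\<close>
    define K where "K = B ^ 4 + 1"
    have K: "0 < K" by (simp add: K_def add_nonneg_pos)
    obtain p where p: "\<forall>M\<in>S. (\<integral>x. (peval q x * f x - peval p x) ^ 4 \<partial>M) < \<epsilon> / K"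
      using qf divide_pos_pos[OF e K] unfolding approx_def by blast
    have "(\<integral>x. (peval q x * (f x * g x) - peval p x * g x) ^ 4 \<partial>M) < \<epsilon>" if M: "M \<in> S" for M
    proof -
      have L: "(\<lambda>x. peval q x * f x - peval p x) \<in> L4"
        by (intro L4_diff approx_L4[OF qf] L4_peval)
      have "(\<integral>x. ((peval q x * f x - peval p x) * g x) ^ 4 \<partial>M)
          \<le> (\<integral>x. K * (peval q x * f x - peval p x) ^ 4 \<partial>M)"
      proof (rule integral_mono)
        show "integrable M (\<lambda>x. ((peval q x * f x - peval p x) * g x) ^ 4)"
          using L4_mult_bounded[OF L, of g B] B M by (simp add: L4_def)
        show "integrable M (\<lambda>x. K * (peval q x * f x - peval p x) ^ 4)"
          using L M by (simp add: L4_def)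
        fix x
        have "g x ^ 4 \<le> K"
          using power_mono[of "\<bar>g x\<bar>" B 4] B by (simp add: K_def)
        then show "((peval q x * f x - peval p x) * g x) ^ 4 \<le> K * (peval q x * f x - peval p x) ^ 4"
          unfolding power_mult_distrib by (subst mult.commute) (simp add: mult_right_mono)
      qed
      also have "\<dots> < \<epsilon>" using p M K by (simp add: field_simps)
      finally show ?thesis by (simp add: left_diff_distrib mult.assoc)
    qed
    moreover have "(\<lambda>x. peval p x * g x) \<in> approx" using g by (simp add: multipliers_def)
    ultimately show "\<exists>h\<in>approx. \<forall>M\<in>S. (\<integral>x. (peval q x * (f x * g x) - h x) ^ 4 \<partial>M) < \<epsilon>"
      by (intro bexI[of _ "\<lambda>x. peval p x * g x"]) simp_all
  qed
  then show ?thesis using AB by (auto simp: multipliers_def)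
qed

text \<open>The uniform bound on \<open>F k\<close> supplies the dominating function
  \<open>\<bar>q\<bar> * B\<close>.\<close>

lemma multipliers_lim:
  assumes F: "\<And>k. F k \<in> multipliers" and lim: "\<And>x. (\<lambda>k. F k x) \<longlonglongrightarrow> f x"
    and B: "\<And>k x. \<bar>F k x\<bar> \<le> B"
  shows "f \<in> multipliers"
proof -
  have [measurable]: "F k \<in> borel_measurable borel" for k
    using F by (auto simp: multipliers_def)
  have f [measurable]: "f \<in> borel_measurable borel"
    using lim by (rule borel_measurable_LIMSEQ_real) auto
  have "\<bar>f x\<bar> \<le> B" for x
    using B by (intro LIMSEQ_le_const2[OF tendsto_rabs[OF lim]]) auto
  moreover have "(\<lambda>x. peval q x * f x) \<in> approx" for q
  proof (rule approx_dominated)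
    show "(\<lambda>x. peval q x * F k x) \<in> approx" for k using F by (simp add: multipliers_def)
    show "(\<lambda>k. peval q x * F k x) \<longlonglongrightarrow> peval q x * f x" for x by (intro tendsto_intros lim)
    have "(\<lambda>x. peval q x * B) \<in> L4"
      by (intro L4_range_peval range_peval_mult range_peval_const) auto
    then show "(\<lambda>x. \<bar>peval q x\<bar> * B) \<in> L4"
      by (simp add: L4_def power_mult_distrib)
    show "\<bar>peval q x * F k x\<bar> \<le> \<bar>peval q x\<bar> * B" for k x
      by (simp add: abs_mult B mult_left_mono)
  qed measurable
  ultimately show ?thesis using f by (auto simp: multipliers_def)
qed

lemma multipliers_polynomial:
  assumes "real_polynomial_function P" "g \<in> multipliers"
  shows "(\<lambda>x. P (g x :: real)) \<in> multipliers"
  using assms(1)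
proof induction
  case (linear h)
  then have "h (g x) = g x * h 1" for x
    using linear_simps(5)[of h "g x" 1] by simp
  then have "(\<lambda>x. h (g x)) = (\<lambda>x. g x * h 1)" by (rule ext)
  then show ?case using multipliers_mult[OF assms(2) multipliers_const] by simp
qed (auto intro: multipliers_const multipliers_add multipliers_mult)

text \<open>The indicator of a half-line is a pointwise limit of continuous ramps, which the
  Weierstrass theorem replaces by polynomials on the bounded range of \<open>g\<close>; polynomials
  in a multiplier are multipliers.\<close>

lemma indicator_greater_multiplier:
  assumes g: "g \<in> multipliers"
  shows "indicator {x. a < g x} \<in> multipliers"
proof -
  obtain B where B: "\<And>x. \<bar>g x\<bar> \<le> B" using g by (auto simp: multipliers_def)
  \<comment> \<open>For positive \<open>n\<close> the ramp is 0 up to \<open>a\<close> and 1 from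
    \<open>a + 1/n\<close> on.\<close>
  define h where "h n t = min 1 (max 0 (real n * (t - a)))" for n t
  have "\<exists>P. real_polynomial_function P \<and> (\<forall>t\<in>{- B..B}. \<bar>h n t - P t\<bar> < inverse (real (Suc n)))" for n
  proof -
    have "continuous_on {- B..B} (h n)"
      unfolding h_def by (intro continuous_intros)
    moreover have "0 < inverse (real (Suc n))" by simp
    ultimately obtain P where "real_polynomial_function P"
      "\<And>t. t \<in> {- B..B} \<Longrightarrow> \<bar>h n t - P t\<bar> < inverse (real (Suc n))"
      by (rule Stone_Weierstrass_real_polynomial_function[OF compact_Icc]) (rule that)
    then show ?thesis by blast
  qed
  then obtain P where P: "\<And>n. real_polynomial_function (P n)"
    and hP: "\<And>n t. t \<in> {- B..B} \<Longrightarrow> \<bar>h n t - P n t\<bar> < inverse (real (Suc n))"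
    by metis
  have gB: "g x \<in> {- B..B}" for x using B[of x] by auto
  show ?thesis
  proof (rule multipliers_lim)
    show "(\<lambda>x. P n (g x)) \<in> multipliers" for n
      using P g by (rule multipliers_polynomial)
    fix x
    have "(\<lambda>n. h n (g x)) \<longlonglongrightarrow> indicator {x. a < g x} x"
    proof (cases "a < g x")
      case True
      have "\<forall>\<^sub>F n in sequentially. 1 \<le> real n * (g x - a)"
      proof -
        obtain N where "1 / (g x - a) \<le> real N" using real_arch_simple by blast
        then have "1 \<le> real n * (g x - a)" if "N \<le> n" for n
        proof -
          have "1 / (g x - a) \<le> real n"
            using that \<open>1 / (g x - a) \<le> real N\<close> by linarith
          then show ?thesis using True by (simp add: field_simps)
        qed
        then show ?thesis by (auto simp: eventually_sequentially)
      qed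
      then have "\<forall>\<^sub>F n in sequentially. h n (g x) = 1"
        by eventually_elim (simp add: h_def)
      then show ?thesis using True by (simp add: tendsto_eventually)
    next
      case False
      then have "real n * (g x - a) \<le> 0" for n
        by (simp add: mult_nonneg_nonpos)
      then have "h n (g x) = 0" for n
        by (simp add: h_def)
      then show ?thesis using False by simp
    qed
    moreover have "(\<lambda>n. h n (g x) - P n (g x)) \<longlonglongrightarrow> 0"
      by (rule Lim_null_comparison[OF _ LIMSEQ_inverse_real_of_nat])
        (use hP[OF gB] in \<open>auto intro!: always_eventually less_imp_le\<close>)
    ultimately have "(\<lambda>n. h n (g x) - (h n (g x) - P n (g x))) \<longlonglongrightarrow> indicator {x. a < g x} x - 0"
      by (rule tendsto_diff)
    then show "(\<lambda>n. P n (g x)) \<longlonglongrightarrow> indicator {x. a < g x} x" by simp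
  next
    fix n x
    \<comment> \<open>A ramp is at most 1 and its polynomial is off by less than 1, whence the
      uniform bound 2.\<close>
    have "0 \<le> h n (g x)" "h n (g x) \<le> 1" by (auto simp: h_def)
    moreover have "\<bar>h n (g x) - P n (g x)\<bar> < 1"
      using hP[OF gB, of n x] inverse_le_1_iff[of "real (Suc n)"] by linarith
    ultimately show "\<bar>P n (g x)\<bar> \<le> 2" by linarith
  qed
qed

text \<open>The Taylor polynomials of the sine are dominated by
  \<open>exp (s * \<bar>x $ i\<bar>)\<close>. The factor 8 comes from a fourth power, doubled when
  the factor \<open>\<bar>q\<bar>\<close> is separated from the exponential.\<close>

lemma sin_multiplier:
  assumes s: "0 < s" "8 * s \<le> c"
  shows "(\<lambda>x. sin (s * x $ i)) \<in> multipliers"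
proof -
  have "(\<lambda>x. peval q x * sin (s * x $ i)) \<in> approx" for q
  proof (rule approx_dominated)
    let ?F = "\<lambda>N x. peval q x * (\<Sum>k<N. sin_coeff k * (s * x $ i) ^ k)"
    show "?F N \<in> approx" for N
      by (intro approx_range_peval range_peval_mult range_peval_sum range_peval_const
          range_peval_power range_peval_nth) auto
    show "(\<lambda>N. ?F N x) \<longlonglongrightarrow> peval q x * sin (s * x $ i)" for x
      using sin_converges[of "s * x $ i"] unfolding sums_def by (intro tendsto_mult) auto
    show "\<bar>?F N x\<bar> \<le> \<bar>peval q x\<bar> * exp (s * \<bar>x $ i\<bar>)" for N x
    proof -
      \<comment> \<open>Each Taylor coefficient of the sine is at most that of the exponential in
        absolute value.\<close>
      have "\<bar>\<Sum>k<N. sin_coeff k * (s * x $ i) ^ k\<bar> \<le> (\<Sum>k<N. \<bar>s * x $ i\<bar> ^ k /\<^sub>R fact k)"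
        by (rule order_trans[OF sum_abs], intro sum_mono)
          (auto simp: sin_coeff_def abs_mult power_abs divide_inverse mult.commute)
      also have "\<dots> \<le> exp \<bar>s * x $ i\<bar>"
        unfolding exp_def by (intro sum_le_suminf summable_exp_generic) auto
      finally show ?thesis using s by (simp add: abs_mult mult_left_mono)
    qed
    have "integrable M (\<lambda>x. (\<bar>peval q x\<bar> * exp (s * \<bar>x $ i\<bar>)) ^ 4)" if M: "M \<in> S" for M
    proof (rule Bochner_Integration.integrable_bound)
      show "integrable M (\<lambda>x. peval q x ^ 8 + exp (c * \<bar>x $ i\<bar>))"
        using M integrable_exp integrable_range_peval[OF M range_peval_power] by auto
      show "(\<lambda>x. (\<bar>peval q x\<bar> * exp (s * \<bar>x $ i\<bar>)) ^ 4) \<in> borel_measurable M"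
        using M by (rule borel_measurable_S) measurable
      show "AE x in M. norm ((\<bar>peval q x\<bar> * exp (s * \<bar>x $ i\<bar>)) ^ 4)
          \<le> norm (peval q x ^ 8 + exp (c * \<bar>x $ i\<bar>))"
      proof (intro AE_I2)
        fix x
        \<comment> \<open>From \<open>u v \<le> u\<^sup>2 + v\<^sup>2\<close> one gets a polynomial
          plus \<open>exp (8 s \<bar>x\<^sub>i\<bar>)\<close>, and both are integrable.\<close>
        define u v where "u = peval q x ^ 4" and "v = exp (s * \<bar>x $ i\<bar>) ^ 4"
        have "0 \<le> u * v" by (simp add: u_def v_def)
        then have "u * v \<le> u\<^sup>2 + v\<^sup>2"
          using sum_squares_bound[of u v] by linarith
        moreover have "v\<^sup>2 \<le> exp (c * \<bar>x $ i\<bar>)"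
          using s by (simp add: v_def mult_right_mono flip: power_mult exp_of_nat_mult mult.assoc)
        moreover have "u\<^sup>2 = peval q x ^ 8" by (simp add: u_def flip: power_mult)
        ultimately show "norm ((\<bar>peval q x\<bar> * exp (s * \<bar>x $ i\<bar>)) ^ 4)
          \<le> norm (peval q x ^ 8 + exp (c * \<bar>x $ i\<bar>))"
          by (simp add: power_mult_distrib u_def v_def)
      qed
    qed
    then show "(\<lambda>x. \<bar>peval q x\<bar> * exp (s * \<bar>x $ i\<bar>)) \<in> L4"
      by (simp add: L4_def)
  qed measurable
  then show ?thesis by (auto simp: multipliers_def intro!: exI[of _ 1])
qed

text \<open>Products of indicators give intersections, \<open>1 - g\<close> gives complements, and
  bounded pointwise limits give countable unions.\<close>

lemma sigma_algebra_multipliers: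
  "sigma_algebra UNIV {Y. indicator Y \<in> multipliers}"
proof -
  have Int: "indicator (X \<inter> Y) \<in> multipliers"
    if "indicator X \<in> multipliers" "indicator Y \<in> multipliers" for X Y
    using multipliers_mult[OF that] by (simp add: indicator_inter_arith[abs_def])
  have Compl: "indicator (- X) \<in> multipliers" if "indicator X \<in> multipliers" for X
  proof -
    have "(\<lambda>x. 1 + (- 1) * indicator X x) \<in> multipliers"
      by (intro multipliers_add multipliers_mult multipliers_const that)
    then show ?thesis by (simp add: indicator_compl[abs_def])
  qed
  have Un: "indicator (X \<union> Y) \<in> multipliers"
    if "indicator X \<in> multipliers" "indicator Y \<in> multipliers" for X Y
    using Compl[OF Int[OF Compl Compl], OF that] by simp
  have empty: "indicator {} \<in> multipliers"
    using multipliers_const[of 0] by (simp add: indicator_def[abs_def])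
  have "algebra UNIV {Y. indicator Y \<in> multipliers}"
    unfolding algebra_iff_Un using empty Compl Un by (auto simp: Compl_eq_Diff_UNIV)
  moreover have "indicator (\<Union>i. A i) \<in> multipliers"
    if A: "range A \<subseteq> {Y. indicator Y \<in> multipliers}" for A :: "nat \<Rightarrow> _"
  proof (rule multipliers_lim)
    show "indicator (\<Union>i<k. A i) \<in> multipliers" for k
      using A by (induction k) (auto simp: lessThan_Suc intro!: empty Un)
    show "(\<lambda>k. indicator (\<Union>i<k. A i) x) \<longlonglongrightarrow> indicator (\<Union>i. A i) x" for x
      by (rule LIMSEQ_indicator_UN)
    show "\<bar>indicator (\<Union>i<k. A i) x\<bar> \<le> (1 :: real)" for k x by (simp add: indicator_def)
  qed
  ultimately show ?thesis
    unfolding sigma_algebra_iff by simp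
qed

text \<open>Superlevel sets of multipliers lie in the \<open>\<sigma>\<close>-algebra of
  \<open>sigma_algebra_multipliers\<close>, so multipliers are measurable for it. The coordinates
  are then measurable as limits of rescaled sines, hence so is the identity map into the Borel
  space.\<close>

lemma indicator_borel_multiplier:
  assumes "Y \<in> sets borel"
  shows "indicator Y \<in> multipliers"
proof -
  interpret sigma_algebra UNIV "{Y. indicator Y \<in> multipliers}"
    by (rule sigma_algebra_multipliers)
  let ?N = "sigma UNIV {Y. indicator Y \<in> multipliers}"
  have sN: "sets ?N = {Y. indicator Y \<in> multipliers}"
    by (simp add: sigma_sets_eq)
  have mult_meas: "g \<in> borel_measurable ?N" if "g \<in> multipliers" for g
    unfolding borel_measurable_iff_greater
    using indicator_greater_multiplier[OF that] sN by simp
  have nth: "(\<lambda>x. x $ i) \<in> borel_measurable ?N" for i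
  proof (rule borel_measurable_LIMSEQ_real)
    \<comment> \<open>The largest scale allowed by \<open>sin_multiplier\<close>, divided by
      \<open>Suc k\<close> to obtain a positive null sequence.\<close>
    define s where "s k = c / 8 / real (Suc k)" for k
    have s: "0 < s k" "8 * s k \<le> c" for k
      using c_pos by (auto simp: s_def field_simps)
    show "(\<lambda>x. sin (s k * x $ i) / s k) \<in> borel_measurable ?N" for k
      using mult_meas[OF sin_multiplier[OF s, of k i]] by measurable
    fix x :: "real ^ 'd"
    have "s \<longlonglongrightarrow> 0"
      unfolding s_def by (intro LIMSEQ_Suc lim_const_over_n)
    then have "filterlim s (at 0) sequentially"
      using s by (auto simp: filterlim_at less_imp_neq[symmetric])
    \<comment> \<open>The derivative of \<open>sin (t * x $ i)\<close> in \<open>t\<close> at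
      0.\<close>
    moreover have "((\<lambda>t. sin (t * x $ i) / t) \<longlongrightarrow> x $ i) (at 0)"
    proof -
      have "((\<lambda>t. sin (t * x $ i)) has_field_derivative x $ i) (at 0)"
        by (auto intro!: derivative_eq_intros)
      then show ?thesis by (simp add: has_field_derivative_iff)
    qed
    ultimately show "(\<lambda>k. sin (s k * x $ i) / s k) \<longlonglongrightarrow> x $ i"
      by (rule filterlim_compose[rotated])
  qed
  have "id \<in> borel_measurable ?N"
    unfolding id_def
  proof (rule borel_measurable_euclidean_space[THEN iffD2], intro ballI)
    fix b :: "real ^ 'd" assume "b \<in> Basis"
    then obtain i where "b = axis i 1" by (auto simp: Basis_vec_def)
    then show "(\<lambda>x. x \<bullet> b) \<in> borel_measurable ?N"
      using nth[of i] by (simp add: inner_axis)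
  qed
  then have "id -` Y \<inter> space ?N \<in> sets ?N" using assms by (rule measurable_sets)
  then show ?thesis using sN by simp
qed

lemma L4_approximation:
  assumes "Y \<in> sets borel" "0 < \<epsilon>"
  shows "\<exists>p. \<forall>M\<in>S. (\<integral>x. (indicator Y x - peval p x) ^ 4 \<partial>M) < \<epsilon>"
proof -
  have "(\<lambda>x. peval 1 x * indicator Y x) \<in> approx"
    using indicator_borel_multiplier[OF assms(1)] by (simp only: multipliers_def) blast
  then show ?thesis using assms(2) by (simp add: approx_def)
qed

end

section \<open>Jordan parts and the semidefinite programs\<close>

lemma integral_Cauchy_Schwarz:
  fixes u v :: "'a \<Rightarrow> real"
  assumes "integrable M (\<lambda>x. (u x)\<^sup>2)" "integrable M (\<lambda>x. (v x)\<^sup>2)" "integrable M (\<lambda>x. u x * v x)"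
  shows "(\<integral>x. u x * v x \<partial>M)\<^sup>2 \<le> (\<integral>x. (u x)\<^sup>2 \<partial>M) * (\<integral>x. (v x)\<^sup>2 \<partial>M)"
proof (rule quadratic_nonneg_discriminant)
  fix t :: real
  have "0 \<le> (\<integral>x. (u x + t * v x)\<^sup>2 \<partial>M)" by simp
  also have "\<dots> = (\<integral>x. (u x)\<^sup>2 + (2 * t * (u x * v x) + t\<^sup>2 * (v x)\<^sup>2) \<partial>M)"
    by (intro Bochner_Integration.integral_cong) (auto simp: power2_sum power_mult_distrib algebra_simps)
  also have "\<dots> = (\<integral>x. (u x)\<^sup>2 \<partial>M) + 2 * t * (\<integral>x. u x * v x \<partial>M) + t\<^sup>2 * (\<integral>x. (v x)\<^sup>2 \<partial>M)"
    using assms by simp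
  finally show "0 \<le> (\<integral>x. (u x)\<^sup>2 \<partial>M) + 2 * t * (\<integral>x. u x * v x \<partial>M) + t\<^sup>2 * (\<integral>x. (v x)\<^sup>2 \<partial>M)" .
qed

text \<open>Additivity in the measure, by induction over nonnegative measurable functions. Stated
  with a sum, it avoids subtracting possibly infinite integrals.\<close>

lemma nn_integral_measure_add:
  assumes s: "sets A = sets C" "sets B = sets C"
    and add: "\<And>X. X \<in> sets C \<Longrightarrow> emeasure C X = emeasure A X + emeasure B X"
    and f: "f \<in> borel_measurable C"
  shows "(\<integral>\<^sup>+x. f x \<partial>C) = (\<integral>\<^sup>+x. f x \<partial>A) + (\<integral>\<^sup>+x. f x \<partial>B)"
  using f
proof induction
  case (cong f g)
  have "space A = space C" "space B = space C"
    using s sets_eq_imp_space_eq by blast+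
  then show ?case
    using cong by (simp cong: nn_integral_cong_simp)
next
  case (set X)
  then show ?case using s add by simp
next
  case (mult u a)
  then have "u \<in> borel_measurable A" "u \<in> borel_measurable B"
    using s measurable_cong_sets by blast+
  then show ?case using mult by (simp add: nn_integral_cmult distrib_left)
next
  case (add u v)
  then have "u \<in> borel_measurable A" "u \<in> borel_measurable B"
    "v \<in> borel_measurable A" "v \<in> borel_measurable B"
    using s measurable_cong_sets by blast+
  then show ?case using add by (simp add: nn_integral_add add_ac)
next
  case (seq U)
  then have U: "U i \<in> borel_measurable A" "U i \<in> borel_measurable B" for i
    using s measurable_cong_sets by blast+
  have inc: "incseq (\<lambda>i. \<integral>\<^sup>+x. U i x \<partial>M)" for M
    using seq.hyps by (auto simp: incseq_def le_fun_def intro!: nn_integral_mono)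
  have "(\<integral>\<^sup>+x. (SUP i. U i) x \<partial>M) = (SUP i. \<integral>\<^sup>+x. U i x \<partial>M)"
    if "\<And>i. U i \<in> borel_measurable M" for M
    using nn_integral_monotone_convergence_SUP[OF _ that] seq.hyps by (simp add: image_comp)
  then show ?case
    using U seq ennreal_SUP_add[OF inc inc, of A B] by simp
qed

text \<open>On the complement \<open>Y\<close> of \<open>A\<close> the measure \<open>Q\<close>
  vanishes, and \<open>P\<close> lives on \<open>Y\<close>. So \<open>\<mu>\<close> restricted to
  \<open>Y\<close> is the sum of \<open>P\<close> and the restriction of \<open>\<nu>\<close> to
  \<open>Y\<close>, and integrals against \<open>P\<close> follow by difference.\<close>

lemma hahn_jordan_integral:
  fixes f :: "'a \<Rightarrow> real"
  assumes hj: "is_hahn_jordan \<mu> \<nu> P Q" and fin: "finite_measure \<mu>" "finite_measure \<nu>"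
    and s: "sets \<nu> = sets \<mu>"
    and A: "A \<in> sets \<mu>" "emeasure P A = 0" "emeasure Q (space \<mu> - A) = 0"
    and f: "integrable \<mu> f" "integrable \<nu> f"
  shows "integrable P f"
    and "(\<integral>x. f x \<partial>P) = (\<integral>x. indicator (space \<mu> - A) x * f x \<partial>\<mu>)
      - (\<integral>x. indicator (space \<mu> - A) x * f x \<partial>\<nu>)"
proof -
  interpret M: finite_measure \<mu> by fact
  interpret N: finite_measure \<nu> by fact
  interpret P: finite_measure P using hj by (simp add: is_hahn_jordan_def)
  interpret Q: finite_measure Q using hj by (simp add: is_hahn_jordan_def)
  have sPQ: "sets P = sets \<mu>" "sets Q = sets \<mu>" using hj by (auto simp: is_hahn_jordan_def)
  define Y where "Y = space \<mu> - A"
  have Y: "Y \<in> sets \<mu>" "Y \<in> sets \<nu>" using A s by (auto simp: Y_def)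
  have e: "emeasure (density \<mu> (indicator Y)) X = emeasure P X + emeasure (density \<nu> (indicator Y)) X"
    if X: "X \<in> sets \<mu>" for X
  proof -
    have X': "X \<in> sets \<nu>" "X \<in> sets P" "Y \<in> sets P" using X s sPQ Y by auto
    have "measure P X = measure P (X \<inter> Y) + measure P (X - Y)"
      using P.finite_measure_Diff'[of X Y] X' by simp
    moreover have "measure P (X - Y) = 0"
    proof -
      have "X - Y \<subseteq> A" using sets.sets_into_space[OF X] by (auto simp: Y_def)
      then have "emeasure P (X - Y) \<le> emeasure P A"
        using A sPQ by (intro emeasure_mono) auto
      then show ?thesis using A by (simp add: measure_def)
    qed
    moreover have "measure Q (X \<inter> Y) = 0"
    proof -
      have "emeasure Q (X \<inter> Y) \<le> emeasure Q Y"
        using Y sPQ by (intro emeasure_mono) auto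
      then show ?thesis using A by (simp add: measure_def Y_def)
    qed
    moreover have "measure P (X \<inter> Y) - measure Q (X \<inter> Y) = measure \<mu> (X \<inter> Y) - measure \<nu> (X \<inter> Y)"
      using hj X Y by (simp add: is_hahn_jordan_def)
    ultimately have "measure \<mu> (Y \<inter> X) = measure P X + measure \<nu> (Y \<inter> X)"
      by (simp add: Int_commute)
    then show ?thesis
      using X X' Y
      by (simp add: emeasure_restricted M.emeasure_eq_measure N.emeasure_eq_measure
          P.emeasure_eq_measure)
  qed
  have nn: "(\<integral>\<^sup>+x. indicator Y x * g x \<partial>\<mu>) = (\<integral>\<^sup>+x. g x \<partial>P) + (\<integral>\<^sup>+x. indicator Y x * g x \<partial>\<nu>)"
    if g: "g \<in> borel_measurable \<mu>" for g
  proof -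
    have g': "g \<in> borel_measurable \<nu>" using g s measurable_cong_sets by blast
    have "(\<integral>\<^sup>+x. g x \<partial>density \<mu> (indicator Y)) =
        (\<integral>\<^sup>+x. g x \<partial>P) + (\<integral>\<^sup>+x. g x \<partial>density \<nu> (indicator Y))"
      using g e s sPQ by (intro nn_integral_measure_add) auto
    then show ?thesis using g g' Y by (simp add: nn_integral_density borel_measurable_indicator)
  qed
  have nonneg: "integrable P g \<and> (\<integral>x. g x \<partial>P) = (\<integral>x. indicator Y x * g x \<partial>\<mu>)
      - (\<integral>x. indicator Y x * g x \<partial>\<nu>)"
    if g: "integrable \<mu> g" "integrable \<nu> g" and pos: "\<And>x. 0 \<le> g x" for g :: "'a \<Rightarrow> real"
  proof -
    have i: "integrable \<mu> (\<lambda>x. indicator Y x * g x)" "integrable \<nu> (\<lambda>x. indicator Y x * g x)"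
      using g integrable_real_mult_indicator[of Y] Y by (auto simp: mult.commute)
    have gm: "g \<in> borel_measurable \<mu>" using g by auto
    then have gP: "g \<in> borel_measurable P" using sPQ measurable_cong_sets by blast
    have "(\<integral>\<^sup>+x. ennreal (indicator Y x * g x) \<partial>\<mu>)
        = (\<integral>\<^sup>+x. ennreal (g x) \<partial>P) + (\<integral>\<^sup>+x. ennreal (indicator Y x * g x) \<partial>\<nu>)"
      using nn[of "\<lambda>x. ennreal (g x)"] gm by (simp add: ennreal_mult' ennreal_indicator)
    then have *: "ennreal (\<integral>x. indicator Y x * g x \<partial>\<mu>)
        = (\<integral>\<^sup>+x. ennreal (g x) \<partial>P) + ennreal (\<integral>x. indicator Y x * g x \<partial>\<nu>)"
      using i pos by (simp add: nn_integral_eq_integral)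
    have "(\<integral>\<^sup>+x. ennreal (g x) \<partial>P) \<noteq> \<infinity>"
    proof
      assume "(\<integral>\<^sup>+x. ennreal (g x) \<partial>P) = \<infinity>"
      with * show False by simp
    qed
    \<comment> \<open>Integrability under \<open>P\<close> is inherited: the identity
      \<open>*\<close> has a finite left side, so its \<open>P\<close>-summand is finite.\<close>
    then have iP: "integrable P g"
      using gP pos by (intro integrableI_nonneg) (auto simp: less_top)
    have "ennreal (\<integral>x. indicator Y x * g x \<partial>\<mu>)
        = ennreal ((\<integral>x. g x \<partial>P) + (\<integral>x. indicator Y x * g x \<partial>\<nu>))"
      using * iP pos by (simp add: nn_integral_eq_integral flip: ennreal_plus)
    then have "(\<integral>x. indicator Y x * g x \<partial>\<mu>) = (\<integral>x. g x \<partial>P) + (\<integral>x. indicator Y x * g x \<partial>\<nu>)"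
      using pos by (subst (asm) ennreal_inj) auto
    then show ?thesis using iP by simp
  qed
  \<comment> \<open>Positive and negative parts reduce the general case to the nonnegative
    one.\<close>
  define g h where "g x = max 0 (f x)" and "h x = max 0 (- f x)" for x
  have fgh: "f = (\<lambda>x. g x - h x)" by (auto simp: g_def h_def)
  have i: "integrable \<mu> g" "integrable \<nu> g" "integrable \<mu> h" "integrable \<nu> h"
    unfolding g_def h_def using f by auto
  have g: "integrable P g" "(\<integral>x. g x \<partial>P) = (\<integral>x. indicator Y x * g x \<partial>\<mu>)
      - (\<integral>x. indicator Y x * g x \<partial>\<nu>)"
    using nonneg[OF i(1,2)] by (auto simp: g_def)
  have h: "integrable P h" "(\<integral>x. h x \<partial>P) = (\<integral>x. indicator Y x * h x \<partial>\<mu>)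
      - (\<integral>x. indicator Y x * h x \<partial>\<nu>)"
    using nonneg[OF i(3,4)] by (auto simp: h_def)
  show "integrable P f" unfolding fgh using g h by simp
  have split: "(\<integral>x. indicator Y x * f x \<partial>M) = (\<integral>x. indicator Y x * g x \<partial>M) - (\<integral>x. indicator Y x * h x \<partial>M)"
    if "integrable M g" "integrable M h" "Y \<in> sets M" for M
    using that integrable_real_mult_indicator[of Y M]
    by (simp add: fgh right_diff_distrib mult.commute)
  have "(\<integral>x. f x \<partial>P) = (\<integral>x. g x \<partial>P) - (\<integral>x. h x \<partial>P)"
    using g h by (simp add: fgh)
  then have "(\<integral>x. f x \<partial>P) = (\<integral>x. indicator Y x * f x \<partial>\<mu>) - (\<integral>x. indicator Y x * f x \<partial>\<nu>)"
    using split[of \<mu>] split[of \<nu>] i Y g(2) h(2) by simp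
  then show "(\<integral>x. f x \<partial>P) = (\<integral>x. indicator (space \<mu> - A) x * f x \<partial>\<mu>)
      - (\<integral>x. indicator (space \<mu> - A) x * f x \<partial>\<nu>)" by (simp add: Y_def)
qed

section \<open>The feasible set: truncation, compactness and existence of minimizers\<close>

lemma feasible_iff:
  "(\<phi>, \<psi>) \<in> feasible \<mu> \<nu> n \<longleftrightarrow>
     \<phi> \<in> extensional (multi_indices (2 * n)) \<and> \<psi> \<in> extensional (multi_indices (2 * n)) \<and>
     (\<forall>\<alpha>\<in>multi_indices (2 * n). \<phi> \<alpha> - \<psi> \<alpha> = moment \<mu> \<alpha> - moment \<nu> \<alpha>) \<and>
     (\<forall>p. Poly_Mapping.keys p \<subseteq> multi_indices n \<longrightarrow>
       0 \<le> riesz \<phi> (p * p) \<and> riesz \<phi> (p * p) \<le> riesz (moment \<mu>) (p * p) \<and>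
       0 \<le> riesz \<psi> (p * p) \<and> riesz \<psi> (p * p) \<le> riesz (moment \<nu>) (p * p))"
  by (auto simp: feasible_def psd_on_riesz_iff psd_le_on_riesz_iff)

lemma keys_square_multi_indices:
  "Poly_Mapping.keys p \<subseteq> multi_indices n \<Longrightarrow> Poly_Mapping.keys (p * p) \<subseteq> multi_indices (2 * n)"
  using keys_mult_multi_indices[of p n p n] by (simp add: mult_2)

lemma riesz_restrict_square:
  assumes "Poly_Mapping.keys p \<subseteq> multi_indices n" "n \<le> m"
  shows "riesz (restrict \<phi> (multi_indices (2 * m))) (p * p) = riesz \<phi> (p * p)"
proof (rule riesz_cong)
  fix \<alpha> assume "\<alpha> \<in> Poly_Mapping.keys (p * p)"
  moreover have "multi_indices (2 * n) \<subseteq> multi_indices (2 * m)"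
    using assms(2) by (intro multi_indices_mono) simp
  ultimately show "restrict \<phi> (multi_indices (2 * m)) \<alpha> = \<phi> \<alpha>"
    using keys_square_multi_indices[OF assms(1)] by auto
qed

text \<open>The constraints of order \<open>m\<close> are among those of order \<open>n\<close>.
  Since feasible vectors are extensional, passing to the smaller order means restricting
  them.\<close>

lemma feasible_restrict:
  fixes \<mu> \<nu> :: "(real ^ 'd) measure"
  assumes "(\<phi>, \<psi>) \<in> feasible \<mu> \<nu> n" "m \<le> n"
  shows "(restrict \<phi> (multi_indices (2 * m)), restrict \<psi> (multi_indices (2 * m))) \<in> feasible \<mu> \<nu> m"
proof -
  have le: "Poly_Mapping.keys p \<subseteq> multi_indices m \<Longrightarrow> Poly_Mapping.keys p \<subseteq> multi_indices n"
    for p :: "nat ^ 'd \<Rightarrow>\<^sub>0 real"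
    using multi_indices_mono[OF assms(2)] by blast
  show ?thesis
    using assms multi_indices_mono[of "2 * m" "2 * n"]
    unfolding feasible_iff by (auto simp: riesz_restrict_square[OF _ order_refl] dest: le)
qed

text \<open>Write the coordinate as a matrix entry. Cauchy-Schwarz bounds it by two diagonal
  entries, and these are bounded by the diagonal of the dominating matrix.\<close>

lemma dominated_coordinate_bound:
  assumes "\<gamma> \<in> multi_indices (2 * n)"
  shows "\<exists>B. \<forall>\<phi>. psd_on (multi_indices n) (moment_matrix \<phi>) \<longrightarrow>
    psd_le_on (multi_indices n) (moment_matrix \<phi>) (moment_matrix \<phi>0) \<longrightarrow> \<bar>\<phi> \<gamma>\<bar> \<le> B"
proof -
  obtain \<alpha> \<beta> where ab: "\<alpha> \<in> multi_indices n" "\<beta> \<in> multi_indices n" "\<gamma> = \<alpha> + \<beta>"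
    using multi_indices_double_split[OF assms] by blast
  let ?X = "\<lambda>\<alpha>. Poly_Mapping.single \<alpha> (1 :: real)"
  have k: "Poly_Mapping.keys (?X \<alpha>) \<subseteq> multi_indices n" "Poly_Mapping.keys (?X \<beta>) \<subseteq> multi_indices n"
    using ab by auto
  have "\<bar>\<phi> \<gamma>\<bar> \<le> sqrt (\<phi>0 (\<alpha> + \<alpha>) * \<phi>0 (\<beta> + \<beta>))"
    if psd: "psd_on (multi_indices n) (moment_matrix \<phi>)"
      and le: "psd_le_on (multi_indices n) (moment_matrix \<phi>) (moment_matrix \<phi>0)" for \<phi>
  proof -
    have "(\<phi> \<gamma>)\<^sup>2 \<le> \<phi> (\<alpha> + \<alpha>) * \<phi> (\<beta> + \<beta>)"
      using riesz_Cauchy_Schwarz[OF psd k] by (simp add: mult_single ab)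
    also have "\<dots> \<le> \<phi>0 (\<alpha> + \<alpha>) * \<phi>0 (\<beta> + \<beta>)"
    proof -
      have "0 \<le> \<phi> (\<alpha> + \<alpha>)" "0 \<le> \<phi> (\<beta> + \<beta>)" "\<phi> (\<alpha> + \<alpha>) \<le> \<phi>0 (\<alpha> + \<alpha>)" "\<phi> (\<beta> + \<beta>) \<le> \<phi>0 (\<beta> + \<beta>)"
        using psd le k[THEN subset_trans[OF order_refl]] unfolding psd_on_riesz_iff psd_le_on_riesz_iff
        by (metis mult_1 mult_single riesz_single)+
      then show ?thesis by (intro mult_mono) auto
    qed
    finally show ?thesis using real_sqrt_le_mono by fastforce
  qed
  then show ?thesis by blast
qed

lemma continuous_on_coordinate [continuous_intros]:
  assumes "continuous_on A f"
  shows "continuous_on A (\<lambda>x. f x i :: 'b::topological_space)"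
  using continuous_on_compose2[OF continuous_on_product_coordinates[of i] assms] by auto

text \<open>In the product topology each constraint is a closed condition, since it involves only
  finitely many coordinates.\<close>

lemma closed_feasible: "closed (feasible \<mu> \<nu> n)"
proof -
  have eq: "feasible \<mu> \<nu> n = {x.
     (\<forall>\<alpha>. \<alpha> \<notin> multi_indices (2 * n) \<longrightarrow> fst x \<alpha> = undefined) \<and>
     (\<forall>\<alpha>. \<alpha> \<notin> multi_indices (2 * n) \<longrightarrow> snd x \<alpha> = undefined) \<and>
     (\<forall>\<alpha>. \<alpha> \<in> multi_indices (2 * n) \<longrightarrow> fst x \<alpha> - snd x \<alpha> = moment \<mu> \<alpha> - moment \<nu> \<alpha>) \<and>
     (\<forall>p. Poly_Mapping.keys p \<subseteq> multi_indices n \<longrightarrow>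
       0 \<le> riesz (fst x) (p * p) \<and> riesz (fst x) (p * p) \<le> riesz (moment \<mu>) (p * p) \<and>
       0 \<le> riesz (snd x) (p * p) \<and> riesz (snd x) (p * p) \<le> riesz (moment \<nu>) (p * p))}"
    by (auto simp: feasible_iff extensional_def)
  show ?thesis
    unfolding eq riesz_def
    by (intro closed_Collect_conj closed_Collect_all closed_Collect_imp open_Collect_const
        closed_Collect_eq closed_Collect_le continuous_intros)
qed

lemma compact_feasible:
  fixes \<mu> \<nu> :: "(real ^ 'd) measure"
  shows "compact (feasible \<mu> \<nu> n)"
proof -
  obtain B where B: "\<And>\<gamma> \<phi>. \<gamma> \<in> multi_indices (2 * n) \<Longrightarrow> psd_on (multi_indices n) (moment_matrix \<phi>) \<Longrightarrow>
    psd_le_on (multi_indices n) (moment_matrix \<phi>) (moment_matrix (moment \<mu>)) \<Longrightarrow> \<bar>\<phi> \<gamma>\<bar> \<le> B \<gamma>"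
    using dominated_coordinate_bound[of _ n "moment \<mu>"] by metis
  obtain C where C: "\<And>\<gamma> \<phi>. \<gamma> \<in> multi_indices (2 * n) \<Longrightarrow> psd_on (multi_indices n) (moment_matrix \<phi>) \<Longrightarrow>
    psd_le_on (multi_indices n) (moment_matrix \<phi>) (moment_matrix (moment \<nu>)) \<Longrightarrow> \<bar>\<phi> \<gamma>\<bar> \<le> C \<gamma>"
    using dominated_coordinate_bound[of _ n "moment \<nu>"] by metis
  \<comment> \<open>A box of intervals over the index set, with a single admissible value elsewhere
    as extensionality demands. It is compact by Tychonoff's theorem.\<close>
  define K where "K B \<gamma> = (if \<gamma> \<in> multi_indices (2 * n) then {- B \<gamma>..B \<gamma>} else {undefined :: real})"
    for B :: "nat ^ 'd \<Rightarrow> real" and \<gamma>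
  have K: "compact (PiE UNIV (K B))" for B
  proof -
    have "compactin (product_topology (\<lambda>i. euclidean) UNIV) (PiE UNIV (K B))"
      unfolding compactin_PiE by (auto simp: K_def)
    then show ?thesis by (simp add: euclidean_product_topology)
  qed
  have "feasible \<mu> \<nu> n \<subseteq> PiE UNIV (K B) \<times> PiE UNIV (K C)"
  proof (rule subrelI)
    fix \<phi> \<psi> assume f: "(\<phi>, \<psi>) \<in> feasible \<mu> \<nu> n"
    then have "\<phi> \<gamma> \<in> K B \<gamma>" "\<psi> \<gamma> \<in> K C \<gamma>" for \<gamma>
      using B[of \<gamma> \<phi>] C[of \<gamma> \<psi>]
      by (auto simp: feasible_def K_def abs_le_iff extensional_def minus_le_iff)
    then show "(\<phi>, \<psi>) \<in> PiE UNIV (K B) \<times> PiE UNIV (K C)" by auto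
  qed
  then show ?thesis
    using compact_Int_closed[OF compact_Times[OF K K] closed_feasible, of B C \<mu> \<nu> n]
    by (simp add: Int_absorb1)
qed

lemma optimal_solution_exists:
  assumes "feasible \<mu> \<nu> n \<noteq> {}"
  shows "\<exists>\<phi> \<psi>. optimal_solution \<mu> \<nu> n \<phi> \<psi>"
proof -
  have "continuous_on (feasible \<mu> \<nu> n) (\<lambda>x. fst x 0 + snd x 0)"
    by (intro continuous_intros)
  then obtain x where "x \<in> feasible \<mu> \<nu> n"
    "\<forall>y\<in>feasible \<mu> \<nu> n. fst x 0 + snd x 0 \<le> fst y 0 + snd y 0"
    using continuous_attains_inf[OF compact_feasible assms] by blast
  then show ?thesis
    by (intro exI[of _ "fst x"] exI[of _ "snd x"]) (auto simp: optimal_solution_def)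
qed

lemma rho_eq_optimal:
  assumes "optimal_solution \<mu> \<nu> n \<phi> \<psi>"
  shows "rho \<mu> \<nu> n = \<phi> 0 + \<psi> 0"
  unfolding rho_def
proof (rule cInf_eq_minimum)
  show "\<phi> 0 + \<psi> 0 \<in> (\<lambda>(\<phi>, \<psi>). \<phi> 0 + \<psi> 0) ` feasible \<mu> \<nu> n"
    using assms by (force simp: optimal_solution_def)
qed (use assms in \<open>auto simp: optimal_solution_def\<close>)

section \<open>Convergence\<close>

locale exp_moment_pair =
  fixes \<mu> \<nu> :: "(real ^ 'd) measure" and c :: real
  assumes pair: "exp_moments {\<mu>, \<nu>} c"
begin

sublocale exp_moments "{\<mu>, \<nu>}" c by (rule pair)

abbreviation "P \<equiv> jordan_pos \<mu> \<nu>"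
abbreviation "Q \<equiv> jordan_neg \<mu> \<nu>"

section \<open>Integration against the Jordan parts\<close>

lemma sets_pair: "sets \<mu> = sets borel" "sets \<nu> = sets borel" "sets \<nu> = sets \<mu>"
  using sets_borel by auto

lemma space_pair: "space \<mu> = UNIV" "space \<nu> = UNIV"
  using sets_pair[THEN sets_eq_imp_space_eq] by auto

lemma finite_pair: "finite_measure \<mu>" "finite_measure \<nu>"
  using finite_measure by auto

lemma hahn_jordan: "is_hahn_jordan \<mu> \<nu> P Q"
  by (rule is_hahn_jordan_jordan_parts[OF finite_pair sets_pair(3)])

text \<open>A positive set of a Hahn decomposition of \<open>\<mu> - \<nu>\<close>, fixed once by
  choice.\<close>

definition pos_set :: "(real ^ 'd) set" where
  "pos_set = (SOME Y. Y \<in> sets borel \<and> emeasure P (- Y) = 0 \<and> emeasure Q Y = 0)"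

lemma pos_set [measurable]: "pos_set \<in> sets borel"
  and pos_set_P: "emeasure P (- pos_set) = 0" and pos_set_Q: "emeasure Q pos_set = 0"
proof -
  have "sets P = sets borel" "sets Q = sets borel"
    using hahn_jordan sets_pair by (auto simp: is_hahn_jordan_def)
  moreover from this(2) have "space Q = UNIV"
    using sets_eq_imp_space_eq by fastforce
  ultimately obtain A where A: "A \<in> sets borel" "emeasure P A = 0" "emeasure Q (UNIV - A) = 0"
    using hahn_jordan by (auto simp: is_hahn_jordan_def mutually_singular_def)
  then have "- A \<in> sets borel \<and> emeasure P (- (- A)) = 0 \<and> emeasure Q (- A) = 0"
    by (simp flip: Compl_eq_Diff_UNIV)
  then have "pos_set \<in> sets borel \<and> emeasure P (- pos_set) = 0 \<and> emeasure Q pos_set = 0"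
    unfolding pos_set_def by (rule someI)
  then show "pos_set \<in> sets borel" "emeasure P (- pos_set) = 0" "emeasure Q pos_set = 0"
    by auto
qed

lemma integral_P:
  fixes f :: "real ^ 'd \<Rightarrow> real"
  assumes "integrable \<mu> f" "integrable \<nu> f"
  shows "integrable P f"
    and "(\<integral>x. f x \<partial>P) = (\<integral>x. indicator pos_set x * f x \<partial>\<mu>) - (\<integral>x. indicator pos_set x * f x \<partial>\<nu>)"
  using hahn_jordan_integral[OF hahn_jordan finite_pair sets_pair(3), of "- pos_set" f]
    assms pos_set pos_set_P pos_set_Q sets_pair space_pair
  by (auto simp: Compl_eq_Diff_UNIV[symmetric])

lemma integral_Q:
  fixes f :: "real ^ 'd \<Rightarrow> real"
  assumes "integrable \<mu> f" "integrable \<nu> f"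
  shows "integrable Q f"
    and "(\<integral>x. f x \<partial>Q) = (\<integral>x. indicator (- pos_set) x * f x \<partial>\<nu>) - (\<integral>x. indicator (- pos_set) x * f x \<partial>\<mu>)"
  using hahn_jordan_integral[OF is_hahn_jordan_swap[OF hahn_jordan sets_pair(3)]
      finite_pair(2,1) sets_pair(3)[symmetric], of pos_set f]
    assms pos_set pos_set_P pos_set_Q sets_pair space_pair
  by (auto simp: Compl_eq_Diff_UNIV[symmetric])

definition \<tau> :: "(real ^ 'd \<Rightarrow> real) \<Rightarrow> real" where
  "\<tau> f = (\<integral>x. f x \<partial>\<mu>) - (\<integral>x. f x \<partial>\<nu>)"

lemma integrable_pair_indicator:
  fixes f :: "real ^ 'd \<Rightarrow> real"
  assumes "M \<in> {\<mu>, \<nu>}" "Y \<in> sets borel" "integrable M f"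
  shows "integrable M (\<lambda>x. indicator Y x * f x)"
  using integrable_real_mult_indicator[of Y M f] assms sets_borel by (auto simp: mult.commute)

lemma integral_indicator_Compl:
  fixes f :: "real ^ 'd \<Rightarrow> real"
  assumes "M \<in> {\<mu>, \<nu>}" "Y \<in> sets borel" "integrable M f"
  shows "(\<integral>x. indicator (- Y) x * f x \<partial>M) = (\<integral>x. f x \<partial>M) - (\<integral>x. indicator Y x * f x \<partial>M)"
proof -
  have "(\<integral>x. indicator (- Y) x * f x \<partial>M) = (\<integral>x. f x - indicator Y x * f x \<partial>M)"
    by (intro Bochner_Integration.integral_cong) (simp_all add: indicator_def)
  then show ?thesis
    using integrable_pair_indicator[OF assms] assms by simp
qed

lemma integral_P_minus_Q:
  fixes f :: "real ^ 'd \<Rightarrow> real"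
  assumes "integrable \<mu> f" "integrable \<nu> f"
  shows "(\<integral>x. f x \<partial>P) - (\<integral>x. f x \<partial>Q) = \<tau> f"
  unfolding integral_P[OF assms] integral_Q[OF assms]
  using integral_indicator_Compl[of \<mu> pos_set f] integral_indicator_Compl[of \<nu> pos_set f] assms
  by (simp add: \<tau>_def)

text \<open>The integral under \<open>P\<close> is that under \<open>\<mu>\<close> minus two
  nonnegative integrals. On squares of polynomials this is the upper matrix bound needed for
  feasibility.\<close>

lemma integral_P_le:
  fixes f :: "real ^ 'd \<Rightarrow> real"
  assumes "integrable \<mu> f" "integrable \<nu> f" "\<And>x. 0 \<le> f x"
  shows "(\<integral>x. f x \<partial>P) \<le> (\<integral>x. f x \<partial>\<mu>)"
proof -
  have "0 \<le> (\<integral>x. indicator (- pos_set) x * f x \<partial>\<mu>)" "0 \<le> (\<integral>x. indicator pos_set x * f x \<partial>\<nu>)"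
    using assms(3) by (auto intro!: Bochner_Integration.integral_nonneg)
  moreover have "(\<integral>x. indicator (- pos_set) x * f x \<partial>\<mu>) = (\<integral>x. f x \<partial>\<mu>) - (\<integral>x. indicator pos_set x * f x \<partial>\<mu>)"
    using assms by (intro integral_indicator_Compl) simp_all
  ultimately show ?thesis
    using integral_P(2)[OF assms(1,2)] by linarith
qed

lemma integral_Q_le:
  fixes f :: "real ^ 'd \<Rightarrow> real"
  assumes "integrable \<mu> f" "integrable \<nu> f" "\<And>x. 0 \<le> f x"
  shows "(\<integral>x. f x \<partial>Q) \<le> (\<integral>x. f x \<partial>\<nu>)"
proof -
  have "0 \<le> (\<integral>x. indicator pos_set x * f x \<partial>\<nu>)" "0 \<le> (\<integral>x. indicator (- pos_set) x * f x \<partial>\<mu>)"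
    using assms(3) by (auto intro!: Bochner_Integration.integral_nonneg)
  moreover have "(\<integral>x. indicator (- pos_set) x * f x \<partial>\<nu>) = (\<integral>x. f x \<partial>\<nu>) - (\<integral>x. indicator pos_set x * f x \<partial>\<nu>)"
    using assms by (intro integral_indicator_Compl) simp_all
  ultimately show ?thesis
    using integral_Q(2)[OF assms(1,2)] by linarith
qed

section \<open>The Jordan parts as feasible points of every order\<close>

lemma integrable_pair_peval:
  assumes "M \<in> {\<mu>, \<nu>}"
  shows "integrable M (peval p)" "integrable M (\<lambda>x. peval p x * peval q x)"
    "integrable M (\<lambda>x. peval p x ^ k)"
  using integrable_range_peval[OF assms] by (auto intro!: range_peval_mult range_peval_power)

lemma riesz_moment_pair:
  "riesz (moment \<mu>) p = (\<integral>x. peval p x \<partial>\<mu>)" "riesz (moment \<nu>) p = (\<integral>x. peval p x \<partial>\<nu>)"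
  "riesz (moment P) p = (\<integral>x. peval p x \<partial>P)" "riesz (moment Q) p = (\<integral>x. peval p x \<partial>Q)"
  by (intro riesz_moment integral_P(1) integral_Q(1) integrable_monomial; simp)+

lemma moment_0:
  "moment \<mu> 0 = measure \<mu> UNIV" "moment \<nu> 0 = measure \<nu> UNIV"
  by (simp_all add: moment_def space_pair)

lemma tv_eq: "tv_norm_diff \<mu> \<nu> = moment P 0 + moment Q 0"
proof -
  have "space P = UNIV" "space Q = UNIV"
    using hahn_jordan sets_pair sets_eq_imp_space_eq space_pair
    unfolding is_hahn_jordan_def by metis+
  then show ?thesis by (simp add: tv_norm_diff_def moment_def space_pair)
qed

lemma moment_diff: "moment P \<alpha> - moment Q \<alpha> = moment \<mu> \<alpha> - moment \<nu> \<alpha>"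
  using integral_P_minus_Q[of "monomial \<alpha>"] integrable_monomial by (simp add: moment_def \<tau>_def)

text \<open>This makes all programs feasible and bounds their optimal values by the total
  variation.\<close>

lemma jordan_feasible:
  "(restrict (moment P) (multi_indices (2 * n)), restrict (moment Q) (multi_indices (2 * n)))
    \<in> feasible \<mu> \<nu> n"
  unfolding feasible_iff
  using moment_diff integral_P_le[of "\<lambda>x. peval p x * peval p x" for p]
    integral_Q_le[of "\<lambda>x. peval p x * peval p x" for p] integrable_pair_peval(2)
  by (auto simp: riesz_restrict_square[OF _ order_refl] riesz_moment_pair peval_mult)

lemma optimal_le_tv:
  assumes "optimal_solution \<mu> \<nu> n \<phi> \<psi>"
  shows "\<phi> 0 + \<psi> 0 \<le> tv_norm_diff \<mu> \<nu>"
  using assms jordan_feasible[of n] unfolding optimal_solution_def tv_eq by fastforce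

lemma exists_optimal: "\<exists>\<phi> \<psi>. optimal_solution \<mu> \<nu> n \<phi> \<psi>"
  using optimal_solution_exists jordan_feasible by blast

text \<open>Truncating an optimal pair of order \<open>n\<close> gives a feasible pair of order
  \<open>m\<close> with the same objective value.\<close>

lemma incseq_rho: "incseq (rho \<mu> \<nu>)"
proof (rule monoI)
  fix m n :: nat assume mn: "m \<le> n"
  obtain \<phi> \<psi> where o: "optimal_solution \<mu> \<nu> m \<phi> \<psi>" using exists_optimal by blast
  obtain \<phi>' \<psi>' where o': "optimal_solution \<mu> \<nu> n \<phi>' \<psi>'" using exists_optimal by blast
  then have "(restrict \<phi>' (multi_indices (2 * m)), restrict \<psi>' (multi_indices (2 * m))) \<in> feasible \<mu> \<nu> m"
    using mn by (intro feasible_restrict) (auto simp: optimal_solution_def)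
  then have "\<phi> 0 + \<psi> 0 \<le> \<phi>' 0 + \<psi>' 0"
    using o unfolding optimal_solution_def by fastforce
  then show "rho \<mu> \<nu> m \<le> rho \<mu> \<nu> n"
    using rho_eq_optimal[OF o] rho_eq_optimal[OF o'] by simp
qed

section \<open>Polynomial approximation of the positive set\<close>

definition p_approx :: "nat \<Rightarrow> nat ^ 'd \<Rightarrow>\<^sub>0 real" where
  "p_approx k = (SOME p. \<forall>M\<in>{\<mu>, \<nu>}.
     (\<integral>x. (indicator pos_set x - peval p x) ^ 4 \<partial>M) < inverse (real (Suc k)))"

abbreviation err :: "nat \<Rightarrow> real ^ 'd \<Rightarrow> real" where
  "err k x \<equiv> indicator pos_set x - peval (p_approx k) x"

lemma p_approx_less:
  assumes "M \<in> {\<mu>, \<nu>}"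
  shows "(\<integral>x. err k x ^ 4 \<partial>M) < inverse (real (Suc k))"
proof -
  have "\<exists>p. \<forall>M\<in>{\<mu>, \<nu>}. (\<integral>x. (indicator pos_set x - peval p x) ^ 4 \<partial>M) < inverse (real (Suc k))"
    by (rule L4_approximation) simp_all
  then have "\<forall>M\<in>{\<mu>, \<nu>}. (\<integral>x. err k x ^ 4 \<partial>M) < inverse (real (Suc k))"
    unfolding p_approx_def by (rule someI_ex)
  then show ?thesis using assms by blast
qed

lemma err_L4_lim:
  assumes "M \<in> {\<mu>, \<nu>}"
  shows "(\<lambda>k. \<integral>x. err k x ^ 4 \<partial>M) \<longlonglongrightarrow> 0"
proof (rule tendsto_sandwich[OF _ _ tendsto_const LIMSEQ_inverse_real_of_nat])
  show "\<forall>\<^sub>F k in sequentially. (\<integral>x. err k x ^ 4 \<partial>M) \<le> inverse (real (Suc k))"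
    using p_approx_less[OF assms] by (intro always_eventually allI less_imp_le)
qed simp

text \<open>One factor \<open>err k\<close> splits into an indicator and a polynomial; the latter is
  absorbed into \<open>q\<close>, which is why the induction generalizes over
  \<open>q\<close>.\<close>

lemma integrable_err_peval:
  assumes M: "M \<in> {\<mu>, \<nu>}"
  shows "integrable M (\<lambda>x. err k x ^ j * peval q x)"
proof (induction j arbitrary: q)
  case 0
  then show ?case using integrable_pair_peval[OF M] by simp
next
  case (Suc j)
  have "integrable M (\<lambda>x. indicator pos_set x * (err k x ^ j * peval q x) - err k x ^ j * peval (p_approx k * q) x)"
    using Suc integrable_pair_indicator[OF M pos_set] by (intro Bochner_Integration.integrable_diff) auto
  then show ?case by (simp add: algebra_simps peval_mult)
qed

lemma integrable_err:
  assumes "M \<in> {\<mu>, \<nu>}"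
  shows "integrable M (\<lambda>x. err k x ^ j)"
  using integrable_err_peval[OF assms, of k j 1] by simp

lemma finite_integrable_const: "M \<in> {\<mu>, \<nu>} \<Longrightarrow> integrable M (\<lambda>x. a :: real)"
  using finite_measure finite_measure.integrable_const by blast

lemma err_L2_lim:
  assumes M: "M \<in> {\<mu>, \<nu>}"
  shows "(\<lambda>k. \<integral>x. (err k x)\<^sup>2 \<partial>M) \<longlonglongrightarrow> 0"
proof -
  \<comment> \<open>Cauchy-Schwarz against the constant 1, which has finite mass.\<close>
  have sq: "(\<integral>x. (err k x)\<^sup>2 \<partial>M)\<^sup>2 \<le> (\<integral>x. err k x ^ 4 \<partial>M) * measure M UNIV" for k
    using integral_Cauchy_Schwarz[of M "\<lambda>x. (err k x)\<^sup>2" "\<lambda>x. 1"] integrable_err[OF M]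
      finite_integrable_const[OF M] M space_pair by (auto simp flip: power_mult)
  have "(\<lambda>k. (\<integral>x. (err k x)\<^sup>2 \<partial>M)\<^sup>2) \<longlonglongrightarrow> 0"
  proof (rule tendsto_sandwich[OF _ _ tendsto_const])
    show "(\<lambda>k. (\<integral>x. err k x ^ 4 \<partial>M) * measure M UNIV) \<longlonglongrightarrow> 0"
      using tendsto_mult_left_zero[OF err_L4_lim[OF M]] .
  qed (use sq in auto)
  then show ?thesis by simp
qed

text \<open>The error tends to 0 in mean square, and \<open>peval q\<close> is square integrable, so
  Cauchy-Schwarz applies to their product.\<close>

lemma integral_p_approx_lim:
  assumes M: "M \<in> {\<mu>, \<nu>}"
  shows "(\<lambda>k. \<integral>x. peval q x * peval (p_approx k) x \<partial>M) \<longlonglongrightarrow> (\<integral>x. indicator pos_set x * peval q x \<partial>M)"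
proof -
  have "(\<lambda>k. (\<integral>x. err k x * peval q x \<partial>M)\<^sup>2) \<longlonglongrightarrow> 0"
  proof (rule tendsto_sandwich[OF _ _ tendsto_const])
    show "(\<lambda>k. (\<integral>x. (err k x)\<^sup>2 \<partial>M) * (\<integral>x. (peval q x)\<^sup>2 \<partial>M)) \<longlonglongrightarrow> 0"
      using tendsto_mult_left_zero[OF err_L2_lim[OF M]] .
    show "\<forall>\<^sub>F k in sequentially. (\<integral>x. err k x * peval q x \<partial>M)\<^sup>2
        \<le> (\<integral>x. (err k x)\<^sup>2 \<partial>M) * (\<integral>x. (peval q x)\<^sup>2 \<partial>M)"
      using integrable_err[OF M] integrable_err_peval[OF M, of _ 1] integrable_pair_peval(3)[OF M]
      by (intro always_eventually allI integral_Cauchy_Schwarz) auto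
  qed simp
  then have "(\<lambda>k. \<integral>x. err k x * peval q x \<partial>M) \<longlonglongrightarrow> 0" by simp
  then have "(\<lambda>k. (\<integral>x. indicator pos_set x * peval q x \<partial>M) - (\<integral>x. err k x * peval q x \<partial>M))
      \<longlonglongrightarrow> (\<integral>x. indicator pos_set x * peval q x \<partial>M) - 0"
    by (intro tendsto_intros)
  moreover have "(\<integral>x. indicator pos_set x * peval q x \<partial>M) - (\<integral>x. err k x * peval q x \<partial>M)
      = (\<integral>x. peval q x * peval (p_approx k) x \<partial>M)" for k
  proof -
    have "integrable M (\<lambda>x. indicator pos_set x * peval q x)" "integrable M (\<lambda>x. err k x * peval q x)"
      using integrable_pair_indicator[OF M pos_set integrable_pair_peval(1)[OF M]]
        integrable_err_peval[OF M, of k 1 q] by simp_all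
    then have "(\<integral>x. indicator pos_set x * peval q x \<partial>M) - (\<integral>x. err k x * peval q x \<partial>M)
        = (\<integral>x. indicator pos_set x * peval q x - err k x * peval q x \<partial>M)" by simp
    also have "\<dots> = (\<integral>x. peval q x * peval (p_approx k) x \<partial>M)"
      by (intro Bochner_Integration.integral_cong) (simp_all add: algebra_simps)
    finally show ?thesis .
  qed
  ultimately show ?thesis by simp
qed

lemma \<tau>_p_approx_lim:
  "(\<lambda>k. \<tau> (peval (q * p_approx k))) \<longlonglongrightarrow> (\<integral>x. peval q x \<partial>P)"
proof -
  have q: "integrable \<mu> (peval q)" "integrable \<nu> (peval q)"
    using integrable_pair_peval by simp_all
  show ?thesis
    unfolding \<tau>_def integral_P(2)[OF q] peval_mult
    by (intro tendsto_diff integral_p_approx_lim) simp_all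
qed

text \<open>The indicator is idempotent. With \<open>f\<close> its value and
  \<open>p = f - e\<close>, the defect \<open>p (1 - p)\<close> equals
  \<open>(2 f - 1) e - e\<^sup>2\<close> where \<open>2 f - 1\<close> is 1 or -1, so its square is
  at most \<open>2 e\<^sup>2 + 2 e\<^sup>4\<close>.\<close>

lemma idempotent_defect_lim:
  assumes M: "M \<in> {\<mu>, \<nu>}"
  shows "(\<lambda>k. \<integral>x. (peval (p_approx k * (1 - p_approx k)) x)\<^sup>2 \<partial>M) \<longlonglongrightarrow> 0"
proof (rule tendsto_sandwich[OF _ _ tendsto_const])
  have "(\<lambda>k. 2 * (\<integral>x. (err k x)\<^sup>2 \<partial>M) + 2 * (\<integral>x. err k x ^ 4 \<partial>M)) \<longlonglongrightarrow> 2 * 0 + 2 * 0"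
    by (intro tendsto_intros err_L2_lim err_L4_lim M)
  then show "(\<lambda>k. 2 * (\<integral>x. (err k x)\<^sup>2 \<partial>M) + 2 * (\<integral>x. err k x ^ 4 \<partial>M)) \<longlonglongrightarrow> 0" by simp
  have "(peval (p_approx k * (1 - p_approx k)) x)\<^sup>2 \<le> 2 * (err k x)\<^sup>2 + 2 * err k x ^ 4" for k x
  proof -
    define f e where "f = (indicator pos_set x :: real)" and "e = err k x"
    have p: "peval (p_approx k) x = f - e" by (simp add: f_def e_def)
    have f: "f = 0 \<or> f = 1" by (simp add: f_def indicator_def)
    then have "((f - e) * (1 - (f - e)))\<^sup>2 = ((2 * f - 1) * e - e\<^sup>2)\<^sup>2"
      by (auto simp: power2_eq_square algebra_simps)
    also have "\<dots> \<le> 2 * ((2 * f - 1) * e)\<^sup>2 + 2 * (e\<^sup>2)\<^sup>2"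
      using sum_squares_bound[of "(2 * f - 1) * e" "- e\<^sup>2"] by (simp add: power2_diff)
    also have "\<dots> = 2 * e\<^sup>2 + 2 * e ^ 4"
      using f by (auto simp flip: power_mult)
    also have "(f - e) * (1 - (f - e)) = peval (p_approx k * (1 - p_approx k)) x"
      by (simp add: peval_mult peval_diff p)
    finally show ?thesis unfolding e_def .
  qed
  then have "(\<integral>x. (peval (p_approx k * (1 - p_approx k)) x)\<^sup>2 \<partial>M)
      \<le> (\<integral>x. 2 * (err k x)\<^sup>2 + 2 * err k x ^ 4 \<partial>M)" for k
    using integrable_err[OF M] integrable_pair_peval(3)[OF M] by (intro integral_mono) auto
  then show "\<forall>\<^sub>F k in sequentially. (\<integral>x. (peval (p_approx k * (1 - p_approx k)) x)\<^sup>2 \<partial>M)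
      \<le> 2 * (\<integral>x. (err k x)\<^sup>2 \<partial>M) + 2 * (\<integral>x. err k x ^ 4 \<partial>M)"
    using integrable_err[OF M] by simp
qed simp

text \<open>The Cauchy-Schwarz bound for the value of a dominated functional at
  \<open>p (1 - p)\<close>, paired with the constant 1.\<close>

definition \<kappa> :: "(real ^ 'd) measure \<Rightarrow> nat \<Rightarrow> real" where
  "\<kappa> M k = sqrt ((\<integral>x. (peval (p_approx k * (1 - p_approx k)) x)\<^sup>2 \<partial>M) * measure M UNIV)"

lemma \<kappa>_lim: "M \<in> {\<mu>, \<nu>} \<Longrightarrow> \<kappa> M \<longlonglongrightarrow> 0"
  unfolding \<kappa>_def using tendsto_real_sqrt[OF tendsto_mult_left_zero[OF idempotent_defect_lim]]
  by simp

text \<open>Half the amount by which \<open>\<tau> (2 p - 1)\<close> misses the total variation,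
  plus the two errors of replacing \<open>1 - p\<close> and \<open>p\<close> by their squares. It
  depends on \<open>k\<close> only, not on the order of the program.\<close>

definition gap :: "nat \<Rightarrow> real" where
  "gap k = (tv_norm_diff \<mu> \<nu> - (2 * \<tau> (peval (p_approx k)) - \<tau> (\<lambda>x. 1))) / 2 + \<kappa> \<mu> k + \<kappa> \<nu> k"

lemma gap_lim: "gap \<longlonglongrightarrow> 0"
proof -
  have "(\<lambda>k. \<tau> (peval (p_approx k))) \<longlonglongrightarrow> moment P 0"
    using \<tau>_p_approx_lim[of 1] by (simp add: moment_def)
  moreover have "\<tau> (\<lambda>x. 1) = moment P 0 - moment Q 0"
    using moment_diff[of 0] by (simp add: \<tau>_def moment_def)
  ultimately have "gap \<longlonglongrightarrow> (tv_norm_diff \<mu> \<nu> - (2 * moment P 0 - (moment P 0 - moment Q 0))) / 2 + 0 + 0"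
    unfolding gap_def using \<kappa>_lim[of \<mu>] \<kappa>_lim[of \<nu>] by (intro tendsto_intros) auto
  then show ?thesis by (simp add: tv_eq)
qed

definition deg_bound :: "nat \<Rightarrow> nat" where
  "deg_bound k = (SOME m. Poly_Mapping.keys (p_approx k) \<subseteq> multi_indices m)"

lemma keys_p_approx: "Poly_Mapping.keys (p_approx k) \<subseteq> multi_indices (deg_bound k)"
  unfolding deg_bound_def by (rule someI_ex) (rule keys_subset_multi_indices)

lemma keys_one_minus_p_approx: "Poly_Mapping.keys (1 - p_approx k) \<subseteq> multi_indices (deg_bound k)"
  using keys_diff[of 1 "p_approx k"] keys_p_approx[of k] by (auto split: if_splits)

section \<open>The defect bound for feasible pairs and the limits it forces\<close>

lemma abs_riesz_le:
  fixes q r :: "nat ^ 'd \<Rightarrow>\<^sub>0 real"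
  assumes "\<And>p. Poly_Mapping.keys p \<subseteq> multi_indices n \<Longrightarrow> 0 \<le> riesz \<phi> (p * p)"
    and "Poly_Mapping.keys q \<subseteq> multi_indices n" "Poly_Mapping.keys r \<subseteq> multi_indices n"
    and "riesz \<phi> (q * q) \<le> a" "riesz \<phi> (r * r) \<le> b"
  shows "\<bar>riesz \<phi> (q * r)\<bar> \<le> sqrt (a * b)"
proof -
  have "(riesz \<phi> (q * r))\<^sup>2 \<le> riesz \<phi> (q * q) * riesz \<phi> (r * r)"
    using assms by (intro riesz_Cauchy_Schwarz) (auto simp: psd_on_riesz_iff)
  also have "\<dots> \<le> a * b"
    using assms(1)[OF assms(2)] assms(1)[OF assms(3)] assms(4,5) by (intro mult_mono) auto
  finally show ?thesis using real_sqrt_le_mono by fastforce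
qed

lemma feasible_square_nonneg:
  assumes "(\<phi>, \<psi>) \<in> feasible \<mu> \<nu> n" "Poly_Mapping.keys p \<subseteq> multi_indices n"
  shows "0 \<le> riesz \<phi> (p * p)" "0 \<le> riesz \<psi> (p * p)"
  using assms unfolding feasible_iff by blast+

lemma feasible_square_le:
  assumes "(\<phi>, \<psi>) \<in> feasible \<mu> \<nu> n" "Poly_Mapping.keys p \<subseteq> multi_indices n"
  shows "riesz \<phi> (p * p) \<le> (\<integral>x. (peval p x)\<^sup>2 \<partial>\<mu>)" "riesz \<psi> (p * p) \<le> (\<integral>x. (peval p x)\<^sup>2 \<partial>\<nu>)"
  using assms unfolding feasible_iff power2_eq_square peval_mult[symmetric] riesz_moment_pair[symmetric]
  by blast+

text \<open>
  With \<open>p = p_approx k\<close>, both \<open>\<phi> (1 - p) - \<phi> ((1 - p)\<^sup>2)\<close> and \<open>\<psi> p - \<psi> (p\<^sup>2)\<close> are values at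
  \<open>p (1 - p)\<close>, hence at most \<open>\<kappa>\<close>, while \<open>\<phi> - \<psi> = \<tau>\<close> gives
  \<open>\<phi> 1 + \<psi> 1 = \<tau> (2 p - 1) + 2 \<phi> (1 - p) + 2 \<psi> p\<close>.
\<close>

lemma feasible_defect:
  assumes f: "(\<phi>, \<psi>) \<in> feasible \<mu> \<nu> n" and n: "2 * deg_bound k \<le> n"
  shows "riesz \<phi> ((1 - p_approx k) * (1 - p_approx k)) + riesz \<psi> (p_approx k * p_approx k)
    \<le> gap k - (tv_norm_diff \<mu> \<nu> - (\<phi> 0 + \<psi> 0)) / 2"
proof -
  let ?p = "p_approx k"
  have le: "multi_indices (deg_bound k) \<subseteq> multi_indices n" "multi_indices (deg_bound k) \<subseteq> multi_indices (2 * n)"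
    using n by (intro multi_indices_mono; simp)+
  have kp: "Poly_Mapping.keys ?p \<subseteq> multi_indices (2 * n)" using keys_p_approx[of k] le by blast
  \<comment> \<open>The degree of \<open>p (1 - p)\<close> itself must be at most \<open>n\<close>,
    because its square is tested against the matrix bounds; hence the factor 2 in the hypothesis on
    \<open>n\<close>.\<close>
  have kd: "Poly_Mapping.keys (?p * (1 - ?p)) \<subseteq> multi_indices n"
    using keys_mult_multi_indices[OF keys_p_approx keys_one_minus_p_approx, of k k]
      multi_indices_mono[OF n] unfolding mult_2 by (rule subset_trans)
  have k1: "Poly_Mapping.keys (1 :: nat ^ 'd \<Rightarrow>\<^sub>0 real) \<subseteq> multi_indices n" by simp
  \<comment> \<open>The trailing factor 1 exhibits the argument as a product to which
    \<open>abs_riesz_le\<close> applies.\<close>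
  have "\<bar>riesz \<phi> (?p * (1 - ?p) * 1)\<bar> \<le> \<kappa> \<mu> k"
    unfolding \<kappa>_def
    using feasible_square_le[OF f kd] feasible_square_le[OF f k1] feasible_square_nonneg[OF f]
    by (intro abs_riesz_le[OF _ kd k1]) (simp_all add: space_pair)
  moreover have "\<bar>riesz \<psi> (?p * (1 - ?p) * 1)\<bar> \<le> \<kappa> \<nu> k"
    unfolding \<kappa>_def
    using feasible_square_le[OF f kd] feasible_square_le[OF f k1] feasible_square_nonneg[OF f]
    by (intro abs_riesz_le[OF _ kd k1]) (simp_all add: space_pair)
  moreover have "riesz \<phi> ?p - riesz \<psi> ?p = \<tau> (peval ?p)"
  proof -
    have "riesz (\<lambda>\<alpha>. \<phi> \<alpha> - \<psi> \<alpha>) ?p = riesz (\<lambda>\<alpha>. moment \<mu> \<alpha> - moment \<nu> \<alpha>) ?p"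
      using f kp by (intro riesz_cong) (auto simp: feasible_iff)
    then show ?thesis by (simp add: riesz_functional_diff riesz_moment_pair \<tau>_def)
  qed
  moreover have "\<phi> 0 - \<psi> 0 = \<tau> (\<lambda>x. 1)"
    using f by (simp add: feasible_iff \<tau>_def moment_0 space_pair)
  moreover have "(1 - ?p) * (1 - ?p) = 1 - ?p - ?p * (1 - ?p) * 1" "?p * ?p = ?p - ?p * (1 - ?p) * 1"
    by (simp_all add: algebra_simps)
  then have "riesz \<phi> ((1 - ?p) * (1 - ?p)) = \<phi> 0 - riesz \<phi> ?p - riesz \<phi> (?p * (1 - ?p) * 1)"
    "riesz \<psi> (?p * ?p) = riesz \<psi> ?p - riesz \<psi> (?p * (1 - ?p) * 1)"
    by (simp_all only: riesz_diff riesz_one)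
  ultimately show ?thesis
    unfolding gap_def by (simp add: field_simps abs_le_iff)
qed

text \<open>Squares have nonnegative values, so the defect bound leaves
  \<open>tv_norm_diff \<mu> \<nu> - rho \<mu> \<nu> n \<le> 2 * gap k\<close> once \<open>n\<close>
  is large for \<open>k\<close>. The index \<open>k\<close> is fixed first, by the
  tolerance.\<close>

lemma rho_lim: "rho \<mu> \<nu> \<longlonglongrightarrow> tv_norm_diff \<mu> \<nu>"
proof (rule LIMSEQ_I)
  fix r :: real assume r: "0 < r"
  obtain k where k: "gap k < r / 2"
    using order_tendstoD(2)[OF gap_lim, of "r / 2"] r by (auto simp: eventually_sequentially)
  have "norm (rho \<mu> \<nu> n - tv_norm_diff \<mu> \<nu>) < r" if n: "2 * deg_bound k \<le> n" for n
  proof -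
    obtain \<phi> \<psi> where o: "optimal_solution \<mu> \<nu> n \<phi> \<psi>" using exists_optimal by blast
    then have f: "(\<phi>, \<psi>) \<in> feasible \<mu> \<nu> n" by (simp add: optimal_solution_def)
    have "multi_indices (deg_bound k) \<subseteq> multi_indices n"
      using n by (intro multi_indices_mono) simp
    then have "0 \<le> riesz \<phi> ((1 - p_approx k) * (1 - p_approx k))" "0 \<le> riesz \<psi> (p_approx k * p_approx k)"
      using keys_p_approx[of k] keys_one_minus_p_approx[of k]
      by (intro feasible_square_nonneg[OF f]; blast)+
    then have "tv_norm_diff \<mu> \<nu> - rho \<mu> \<nu> n \<le> 2 * gap k"
      using feasible_defect[OF f n] rho_eq_optimal[OF o] by (simp add: field_simps)
    then show ?thesis
      using optimal_le_tv[OF o] rho_eq_optimal[OF o] k by simp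
  qed
  then show "\<exists>no. \<forall>n\<ge>no. norm (rho \<mu> \<nu> n - tv_norm_diff \<mu> \<nu>) < r" by blast
qed

text \<open>One term each for \<open>\<phi> (x\<^sup>\<alpha> (1 - p))\<close>, for
  \<open>\<psi> (x\<^sup>\<alpha> p)\<close> and for the distance of
  \<open>\<tau> (x\<^sup>\<alpha> p)\<close> from its limit. Like \<open>gap\<close>, it is
  independent of \<open>n\<close>.\<close>

definition rate :: "nat ^ 'd \<Rightarrow> nat \<Rightarrow> real" where
  "rate \<alpha> k = sqrt (moment \<mu> (\<alpha> + \<alpha>) * gap k) + sqrt (moment \<nu> (\<alpha> + \<alpha>) * gap k)
    + \<bar>\<tau> (peval (Poly_Mapping.single \<alpha> 1 * p_approx k)) - moment P \<alpha>\<bar>"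

lemma rate_lim: "rate \<alpha> \<longlonglongrightarrow> 0"
proof -
  have "(\<lambda>k. \<tau> (peval (Poly_Mapping.single \<alpha> 1 * p_approx k))) \<longlonglongrightarrow> moment P \<alpha>"
    using \<tau>_p_approx_lim[of "Poly_Mapping.single \<alpha> 1"] by (simp add: moment_def)
  then have "rate \<alpha> \<longlonglongrightarrow> sqrt (moment \<mu> (\<alpha> + \<alpha>) * 0) + sqrt (moment \<nu> (\<alpha> + \<alpha>) * 0)
      + \<bar>moment P \<alpha> - moment P \<alpha>\<bar>"
    unfolding rate_def by (intro tendsto_intros gap_lim)
  then show ?thesis by simp
qed

lemma optimal_moment_error:
  assumes o: "optimal_solution \<mu> \<nu> n \<phi> \<psi>" and n: "2 * deg_bound k \<le> n" and \<alpha>: "\<alpha> \<in> multi_indices n"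
  shows "\<bar>\<phi> \<alpha> - moment P \<alpha>\<bar> \<le> rate \<alpha> k"
proof -
  let ?p = "p_approx k"
  let ?X = "Poly_Mapping.single \<alpha> (1 :: real)"
  have f: "(\<phi>, \<psi>) \<in> feasible \<mu> \<nu> n" using o by (simp add: optimal_solution_def)
  have le: "multi_indices (deg_bound k) \<subseteq> multi_indices n"
    using n by (intro multi_indices_mono) simp
  have k: "Poly_Mapping.keys ?X \<subseteq> multi_indices n" "Poly_Mapping.keys ?p \<subseteq> multi_indices n"
    "Poly_Mapping.keys (1 - ?p) \<subseteq> multi_indices n"
    using \<alpha> le keys_p_approx[of k] keys_one_minus_p_approx[of k] by auto
  have pos: "0 \<le> riesz \<phi> ((1 - ?p) * (1 - ?p))" "0 \<le> riesz \<psi> (?p * ?p)"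
    using feasible_square_nonneg[OF f] k by simp_all
  have "0 \<le> (tv_norm_diff \<mu> \<nu> - (\<phi> 0 + \<psi> 0)) / 2"
    using optimal_le_tv[OF o] by simp
  \<comment> \<open>Optimality enters here: the objective value does not exceed the total variation,
    so the defect bound loses its last term, and each nonnegative square is separately at most
    \<open>gap k\<close>.\<close>
  then have gap: "riesz \<phi> ((1 - ?p) * (1 - ?p)) \<le> gap k" "riesz \<psi> (?p * ?p) \<le> gap k"
    using pos feasible_defect[OF f n] by linarith+
  have X: "riesz \<phi> (?X * ?X) \<le> moment \<mu> (\<alpha> + \<alpha>)" "riesz \<psi> (?X * ?X) \<le> moment \<nu> (\<alpha> + \<alpha>)"
    using f k(1) unfolding feasible_iff by (auto simp: mult_single dest!: spec[of _ ?X])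
  have 1: "\<bar>riesz \<phi> (?X * (1 - ?p))\<bar> \<le> sqrt (moment \<mu> (\<alpha> + \<alpha>) * gap k)"
    using f gap X k by (intro abs_riesz_le[of n]) (auto simp: feasible_iff)
  have 2: "\<bar>riesz \<psi> (?X * ?p)\<bar> \<le> sqrt (moment \<nu> (\<alpha> + \<alpha>) * gap k)"
    using f gap X k by (intro abs_riesz_le[of n]) (auto simp: feasible_iff)
  have "Poly_Mapping.keys (?X * ?p) \<subseteq> multi_indices (2 * n)"
    using keys_mult_multi_indices[OF k(1,2)] by (simp add: mult_2)
  then have "riesz (\<lambda>\<alpha>. \<phi> \<alpha> - \<psi> \<alpha>) (?X * ?p) = riesz (\<lambda>\<alpha>. moment \<mu> \<alpha> - moment \<nu> \<alpha>) (?X * ?p)"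
    using f by (intro riesz_cong) (auto simp: feasible_iff)
  then have "riesz \<phi> (?X * ?p) - riesz \<psi> (?X * ?p) = \<tau> (peval (?X * ?p))"
    by (simp add: riesz_functional_diff riesz_moment_pair \<tau>_def)
  \<comment> \<open>Near the complement of the positive set \<open>\<phi>\<close> is small, and on
    the rest it is exchanged for \<open>\<psi>\<close>, also small there, plus
    \<open>\<tau>\<close>.\<close>
  moreover have "\<phi> \<alpha> = riesz \<phi> (?X * (1 - ?p)) + riesz \<phi> (?X * ?p)"
    by (simp add: algebra_simps riesz_diff flip: riesz_add)
  ultimately show ?thesis
    using 1 2 unfolding rate_def by linarith
qed

lemma optimal_moment_lim:
  assumes o: "\<And>n. optimal_solution \<mu> \<nu> n (\<phi> n) (\<psi> n)"
  shows "(\<lambda>n. \<phi> n \<alpha>) \<longlonglongrightarrow> moment P \<alpha>" and "(\<lambda>n. \<psi> n \<alpha>) \<longlonglongrightarrow> moment Q \<alpha>"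
proof -
  obtain m where m: "\<alpha> \<in> multi_indices m" by (auto simp: multi_indices_def)
  have mem: "\<alpha> \<in> multi_indices n" if "m \<le> n" for n
    using m multi_indices_mono[OF that] by blast
  show lim: "(\<lambda>n. \<phi> n \<alpha>) \<longlonglongrightarrow> moment P \<alpha>"
  proof (rule LIMSEQ_I)
    fix r :: real assume "0 < r"
    then obtain k where k: "rate \<alpha> k < r"
      using order_tendstoD(2)[OF rate_lim, of r \<alpha>] by (auto simp: eventually_sequentially)
    have "norm (\<phi> n \<alpha> - moment P \<alpha>) < r" if "max m (2 * deg_bound k) \<le> n" for n
      using optimal_moment_error[OF o, of k n \<alpha>] mem[of n] that k by simp
    then show "\<exists>no. \<forall>n\<ge>no. norm (\<phi> n \<alpha> - moment P \<alpha>) < r" by blast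
  qed
  have "(\<lambda>n. \<phi> n \<alpha> - (moment \<mu> \<alpha> - moment \<nu> \<alpha>)) \<longlonglongrightarrow> moment P \<alpha> - (moment \<mu> \<alpha> - moment \<nu> \<alpha>)"
    by (intro tendsto_intros lim)
  moreover have "moment P \<alpha> - (moment \<mu> \<alpha> - moment \<nu> \<alpha>) = moment Q \<alpha>"
    using moment_diff[of \<alpha>] by simp
  \<comment> \<open>Only eventually true: for small \<open>n\<close> the index
    \<open>\<alpha>\<close> may lie outside \<open>multi_indices (2 * n)\<close>, where both vectors
    are \<open>undefined\<close> and the moment constraint says nothing.\<close>
  moreover have "\<forall>\<^sub>F n in sequentially. \<phi> n \<alpha> - (moment \<mu> \<alpha> - moment \<nu> \<alpha>) = \<psi> n \<alpha>"
    unfolding eventually_sequentially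
  proof (intro exI[of _ m] allI impI)
    fix n assume "m \<le> n"
    then have "\<alpha> \<in> multi_indices (2 * n)" using mem[of "2 * n"] by simp
    then show "\<phi> n \<alpha> - (moment \<mu> \<alpha> - moment \<nu> \<alpha>) = \<psi> n \<alpha>"
      using o[of n] by (auto simp: optimal_solution_def feasible_iff)
  qed
  ultimately show "(\<lambda>n. \<psi> n \<alpha>) \<longlonglongrightarrow> moment Q \<alpha>"
    by (simp add: Lim_transform_eventually)
qed

end

theorem theorem3p1:
  fixes \<mu> \<nu> :: "(real ^ 'd) measure" and c :: real
  assumes fin_\<mu>: "finite_measure \<mu>" and borel_\<mu>: "sets \<mu> = sets borel"
    and fin_\<nu>: "finite_measure \<nu>" and borel_\<nu>: "sets \<nu> = sets borel"
    and mom_\<mu>: "\<And>\<alpha>. integrable \<mu> (monomial \<alpha>)"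
    and mom_\<nu>: "\<And>\<alpha>. integrable \<nu> (monomial \<alpha>)"
    and c_pos: "c > 0"
    and exp_\<mu>: "\<And>i. integrable \<mu> (\<lambda>x. exp (c * \<bar>x $ i\<bar>))"
    and exp_\<nu>: "\<And>i. integrable \<nu> (\<lambda>x. exp (c * \<bar>x $ i\<bar>))"
  shows "(\<forall>n. \<exists>\<phi> \<psi>. optimal_solution \<mu> \<nu> n \<phi> \<psi>) \<and>
    incseq (rho \<mu> \<nu>) \<and>
    rho \<mu> \<nu> \<longlonglongrightarrow> tv_norm_diff \<mu> \<nu> \<and>
    (\<forall>\<phi> \<psi>. (\<forall>n. optimal_solution \<mu> \<nu> n (\<phi> n) (\<psi> n)) \<longrightarrow>
      (\<forall>\<alpha>. (\<lambda>n. \<phi> n \<alpha>) \<longlonglongrightarrow> moment (jordan_pos \<mu> \<nu>) \<alpha> \<and>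
           (\<lambda>n. \<psi> n \<alpha>) \<longlonglongrightarrow> moment (jordan_neg \<mu> \<nu>) \<alpha>))"
proof -
  interpret exp_moment_pair \<mu> \<nu> c
  proof (intro exp_moment_pair.intro exp_moments.intro)
    show "finite {\<mu>, \<nu>}" "0 < c" by (simp_all only: finite.intros c_pos)
  next
    fix M assume M: "M \<in> {\<mu>, \<nu>}"
    show "finite_measure M" "sets M = sets borel"
      using M by (elim insertE emptyE; simp only: assms)+
    show "integrable M (monomial \<alpha>)" for \<alpha>
      using M by (elim insertE emptyE; simp only: assms)
    show "integrable M (\<lambda>x. exp (c * \<bar>x $ i\<bar>))" for i
      using M by (elim insertE emptyE; simp only: assms)
  qed
  show ?thesis
    by (intro conjI allI impI exists_optimal incseq_rho rho_lim optimal_moment_lim; blast)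
qed

end
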